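(* Let $\beta>0$ be a fixed constant and let $\gamma\in(0,1]$. For each $n\ge 2$ let $a_1=a_1(n)$ and $a_2=a_2(n)$ satisfy $a_1,a_2>\frac{\beta}{2}(n-1)$, and let $\lambda_1,\dots,\lambda_n$ be random variables with the $\beta$-Jacobi joint density $f_{\beta,a_1,a_2}(\lambda)$ on $[0,1]^n$. Set $$\mu_n=\frac1n\sum_{i=1}^n \delta_{\frac{a_2}{n}\lambda_i},$$ where $\delta_x$ is the unit point mass at $x$. Assume that $n\to\infty$, $a_1\to\infty$ and $a_2\to\infty$ in such a way that $a_1=o(\sqrt{a_2})$, $n=o(\sqrt{a_2})$ and $\frac{n\beta}{2a_1}\to\gamma$. Then $d(\mu_n,\mu_0)$ converges to zero in probability, where $\mu_0$ is the probability measure on $\mathbb{R}$ with density $x\mapsto c\, f_\gamma(cx)$, $c=2\gamma/\beta$.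
   Context: The $\beta$-Jacobi ensemble with parameters $a_1,a_2>\frac{\beta}{2}(n-1)$ has density on $[0,1]^n$ $$f_{\beta,a_1,a_2}(\lambda)=c_J^{\beta,a_1,a_2}\prod_{1\le i<j\le n}|\lambda_i-\lambda_j|^\beta\prod_{i=1}^n\lambda_i^{a_1-p}(1-\lambda_i)^{a_2-p},\qquad p=1+\tfrac{\beta}{2}(n-1),$$ with normalizing constant $$c_J^{\beta,a_1,a_2}=\prod_{j=1}^n\frac{\Gamma(1+\frac\beta2)\Gamma(a_1+a_2-\frac\beta2(n-j))}{\Gamma(1+\frac\beta2 j)\Gamma(a_1-\frac\beta2(n-j))\Gamma(a_2-\frac\beta2(n-j))}.$$ The metric $d$ on Borel probability measures on $\mathbb{R}^k$ (here $k=1$) is $$d(\mu,\nu)=\sup_{\|f\|_{BL}\le 1}\Big|\int f\,d\mu-\int f\,d\nu\Big|,\qquad \|f\|_{BL}=\sup_{x\ne y}\frac{|f(x)-f(y)|}{\|x-y\|}+\sup_x|f(x)|,$$ the supremum being over bounded Lipschitz functions $f$; it metrizes weak convergence. The Marchenko–Pastur density is, with $\gamma_{min}=(\sqrt\gamma-1)^2$ and $\gamma_{max}=(\sqrt\gamma+1)^2$, $$f_\gamma(x)=\frac{1}{2\pi\gamma x}\sqrt{(x-\gamma_{min})(\gamma_{max}-x)}\ \text{ for } x\in[\gamma_{min},\gamma_{max}],\qquad f_\gamma(x)=0 \text{ otherwise.}$$ *)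

theory Defs
  imports "HOL-Probability.Probability"
begin

(* 0 powr a = 0 for every a in HOL, also for a <= 0; this only affects the density on the
   Lebesgue null set where some coordinate is 0 or 1 (coinciding coordinates are harmless
   for beta > 0). *)

definition jacobi_const :: "nat \<Rightarrow> real \<Rightarrow> real \<Rightarrow> real \<Rightarrow> real" where
  "jacobi_const n \<beta> a1 a2 =
     (\<Prod>j=1..n. (Gamma (1 + \<beta> / 2) * Gamma (a1 + a2 - \<beta> / 2 * (real n - real j))) /
        (Gamma (1 + \<beta> / 2 * real j) * Gamma (a1 - \<beta> / 2 * (real n - real j))
          * Gamma (a2 - \<beta> / 2 * (real n - real j))))"

definition jacobi_density ::
    "nat \<Rightarrow> real \<Rightarrow> real \<Rightarrow> real \<Rightarrow> (nat \<Rightarrow> real) \<Rightarrow> real" where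
  "jacobi_density n \<beta> a1 a2 l =
     (let p = 1 + \<beta> / 2 * (real n - 1) in
      if (\<forall>i\<in>{1..n}. l i \<in> {0..1})
      then jacobi_const n \<beta> a1 a2
           * (\<Prod>(i, j)\<in>{(i, j). 1 \<le> i \<and> i < j \<and> j \<le> n}. \<bar>l i - l j\<bar> powr \<beta>)
           * (\<Prod>i=1..n. l i powr (a1 - p) * (1 - l i) powr (a2 - p))
      else 0)"

definition mp_density :: "real \<Rightarrow> real \<Rightarrow> real" where
  "mp_density \<gamma> x =
     (let gmin = (sqrt \<gamma> - 1)\<^sup>2; gmax = (sqrt \<gamma> + 1)\<^sup>2 in
      if x \<in> {gmin..gmax}
      then 1 / (2 * pi * \<gamma> * x) * sqrt ((x - gmin) * (gmax - x)) else 0)"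

definition empirical_measure :: "nat \<Rightarrow> (nat \<Rightarrow> 'a::topological_space) \<Rightarrow> 'a measure" where
  "empirical_measure n x =
     measure_of UNIV (sets borel)
       (\<lambda>A. (\<Sum>i=1..n. emeasure (return borel (x i)) A) / of_nat n)"

(* Real-valued suprema: bl_norm f is meaningful only for bounded Lipschitz f, and is used
   only for those in bl_dist. *)

definition bl_norm :: "('a::euclidean_space \<Rightarrow> real) \<Rightarrow> real" where
  "bl_norm f =
     (SUP (x, y)\<in>{(x, y). x \<noteq> y}. \<bar>f x - f y\<bar> / norm (x - y)) + (SUP x. \<bar>f x\<bar>)"

definition bl_ball :: "('a::euclidean_space \<Rightarrow> real) set" where
  "bl_ball = {f. bounded (range f) \<and> (\<exists>L. L-lipschitz_on UNIV f) \<and> bl_norm f \<le> 1}"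

definition bl_dist :: "'a::euclidean_space measure \<Rightarrow> 'a measure \<Rightarrow> real" where
  "bl_dist \<mu> \<nu> = (SUP f\<in>bl_ball. \<bar>(\<integral>x. f x \<partial>\<mu>) - (\<integral>x. f x \<partial>\<nu>)\<bar>)"


lemma empirical_measure_eq:
  fixes x :: "nat \<Rightarrow> 'a::topological_space"
  assumes "n \<ge> 1"
  shows "empirical_measure n x = distr (uniform_count_measure {1..n}) borel x"
proof -
  let ?D = "distr (uniform_count_measure {1..n}) borel x"
  have m: "x \<in> measurable (uniform_count_measure {1..n}) borel"
    by (auto simp: measurable_def space_uniform_count_measure sets_uniform_count_measure)
  have e: "emeasure ?D A = (\<Sum>i=1..n. emeasure (return borel (x i)) A) / of_nat n"
    if "A \<in> sets borel" for A
  proof -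
    have "emeasure ?D A = ennreal (real (card (x -` A \<inter> {1..n})) / real n)"
      using that by (subst emeasure_distr[OF m])
        (auto simp: space_uniform_count_measure emeasure_uniform_count_measure)
    also have "\<dots> = of_nat (card (x -` A \<inter> {1..n})) / of_nat n"
      using assms by (simp add: divide_ennreal[symmetric] ennreal_of_nat_eq_real_of_nat)
    also have "of_nat (card (x -` A \<inter> {1..n})) = (\<Sum>i=1..n. indicator A (x i) :: ennreal)"
      by (simp add: indicator_def sum.If_cases Int_commute vimage_def Int_def conj_commute)
    finally show ?thesis using that by simp
  qed
  have "empirical_measure n x = measure_of UNIV (sets borel) (emeasure ?D)"
    unfolding empirical_measure_def
    by (rule measure_of_eq) (use e in \<open>auto simp: sets.sigma_sets_eq[of borel, simplified]\<close>)
  also have "\<dots> = ?D"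
    using measure_of_of_measure[of ?D] by simp
  finally show ?thesis .
qed

lemma prob_space_empirical_measure:
  assumes "n \<ge> 1"
  shows "prob_space (empirical_measure n x)"
  unfolding empirical_measure_eq[OF assms]
  using assms by (intro prob_space.prob_space_distr prob_space_uniform_count_measure)
    (auto simp: measurable_def space_uniform_count_measure sets_uniform_count_measure)

lemma integral_empirical_measure:
  fixes f :: "'a::topological_space \<Rightarrow> real"
  assumes "n \<ge> 1" "f \<in> borel_measurable borel"
  shows "(\<integral>y. f y \<partial>empirical_measure n x) = (\<Sum>i=1..n. f (x i)) / real n"
  unfolding empirical_measure_eq[OF assms(1)]
  by (subst integral_distr)
    (use assms in \<open>auto simp: measurable_def space_uniform_count_measure
       sets_uniform_count_measure integral_uniform_count_measure\<close>)

lemma bl_ballD: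
  fixes f :: "'a::euclidean_space \<Rightarrow> real"
  assumes "f \<in> bl_ball"
  shows "continuous_on UNIV f" "\<bar>f x\<bar> \<le> 1" "\<bar>f x - f y\<bar> \<le> norm (x - y)"
proof -
  from assms obtain L where L: "L-lipschitz_on UNIV f" and b: "bounded (range f)"
    and n: "bl_norm f \<le> 1"
    by (auto simp: bl_ball_def)
  show "continuous_on UNIV f" using L by (rule lipschitz_on_continuous_on)
  let ?S = "{(x::'a, y). x \<noteq> y}" and ?q = "\<lambda>(x, y). \<bar>f x - f y\<bar> / norm (x - y)"
  have b1: "bdd_above (?q ` ?S)"
    using lipschitz_onD[OF L]
    by (intro bdd_aboveI[of _ L]) (auto simp: dist_norm divide_simps)
  have b2: "bdd_above (range (\<lambda>x. \<bar>f x\<bar>))"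
    using b by (auto simp: bounded_iff bdd_above_def)
  obtain e :: 'a where e: "e \<in> Basis" using nonempty_Basis by blast
  have S0: "0 \<le> (SUP z\<in>?S. ?q z)"
    by (rule cSUP_upper2[OF b1, of "(e, 0)"]) (use e nonzero_Basis in auto)
  have S1: "0 \<le> (SUP x. \<bar>f x\<bar>)"
    by (rule cSUP_upper2[OF b2, of 0]) auto
  have "\<bar>f x\<bar> \<le> (SUP x. \<bar>f x\<bar>)" by (rule cSUP_upper[OF _ b2]) auto
  then show "\<bar>f x\<bar> \<le> 1" using S0 n by (simp add: bl_norm_def)
  show "\<bar>f x - f y\<bar> \<le> norm (x - y)"
  proof (cases "x = y")
    case False
    have "?q (x, y) \<le> (SUP z\<in>?S. ?q z)" by (rule cSUP_upper[OF _ b1]) (use False in auto)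
    then have "\<bar>f x - f y\<bar> / norm (x - y) \<le> 1" using S1 n by (simp add: bl_norm_def)
    then show ?thesis using False by (simp add: divide_simps)
  qed simp
qed

lemma zero_in_bl_ball: "(\<lambda>_. 0) \<in> bl_ball"
proof -
  have "{(x::'a, y). x \<noteq> y} \<noteq> {}"
  proof -
    obtain e :: 'a where "e \<in> Basis" using nonempty_Basis by blast
    then have "(e, 0) \<in> {(x::'a, y). x \<noteq> y}" using nonzero_Basis by auto
    then show ?thesis by blast
  qed
  then show ?thesis
    by (auto simp: bl_ball_def bl_norm_def case_prod_unfold intro!: exI[of _ 0] lipschitz_onI)
qed

lemma bdd_above_bl_dist:
  fixes \<mu> \<nu> :: "'a::euclidean_space measure"
  assumes "prob_space \<mu>" "prob_space \<nu>"
  shows "bdd_above ((\<lambda>f. \<bar>(\<integral>x. f x \<partial>\<mu>) - (\<integral>x. f x \<partial>\<nu>)\<bar>) ` bl_ball)"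
proof -
  have *: "\<bar>\<integral>x. f x \<partial>M\<bar> \<le> 1" if "prob_space M" "f \<in> bl_ball"
    for M and f :: "'a \<Rightarrow> real"
  proof -
    interpret prob_space M by fact
    show ?thesis
    proof (cases "integrable M f")
      case True
      have "\<bar>\<integral>x. f x \<partial>M\<bar> \<le> (\<integral>x. \<bar>f x\<bar> \<partial>M)" by (rule integral_abs_bound)
      also have "\<dots> \<le> 1" using True bl_ballD(2)[OF that(2)]
        by (intro integral_le_const) auto
      finally show ?thesis .
    qed (simp add: not_integrable_integral_eq)
  qed
  show ?thesis
  proof (rule bdd_aboveI2[of _ _ 2])
    fix f :: "'a \<Rightarrow> real" assume f: "f \<in> bl_ball"
    show "\<bar>(\<integral>x. f x \<partial>\<mu>) - (\<integral>x. f x \<partial>\<nu>)\<bar> \<le> 2"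
      using *[OF assms(1) f] *[OF assms(2) f] by linarith
  qed
qed

(* measure assigns 0 to nonmeasurable sets, so an event such as {bl_dist (...) > e} has to be
   known to be measurable for its measure to mean anything. *)

lemma borel_measurable_bl_dist_empirical:
  fixes X :: "nat \<Rightarrow> 'a \<Rightarrow> real"
  assumes n: "n \<ge> 1" and X: "\<And>i. i \<in> {1..n} \<Longrightarrow> X i \<in> borel_measurable M"
    and \<nu>: "prob_space \<nu>"
  shows "(\<lambda>\<omega>. bl_dist (empirical_measure n (\<lambda>i. X i \<omega>)) \<nu>) \<in> borel_measurable M"
proof -
  let ?Y = "\<lambda>\<omega> i. if i \<in> {1..n} then X i \<omega> else 0"
  let ?h = "\<lambda>x. bl_dist (empirical_measure n x) \<nu>"
  have "?Y \<in> measurable M (Pi\<^sub>M UNIV (\<lambda>_. borel))"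
  proof (rule measurable_PiM_single')
    show "(\<lambda>\<omega>. ?Y \<omega> i) \<in> borel_measurable M" for i
      using X[of i] by (cases "i \<in> {1..n}") auto
  qed auto
  then have Y: "?Y \<in> measurable M borel"
    by (simp add: measurable_cong_sets[OF refl sets_PiM_equal_borel])
  have h: "?h \<in> borel_measurable borel"
  proof (rule borel_measurableI_greater)
    fix y
    let ?U = "\<lambda>f. {x :: nat \<Rightarrow> real. y < \<bar>(\<Sum>i=1..n. f (x i)) / real n - (\<integral>x. f x \<partial>\<nu>)\<bar>}"
    have i: "(\<integral>y. f y \<partial>empirical_measure n x) = (\<Sum>i=1..n. f (x i)) / real n"
      if "f \<in> bl_ball" for f and x :: "nat \<Rightarrow> real"
      by (rule integral_empirical_measure[OF n]) (rule borel_measurable_continuous_onI[OF bl_ballD(1)[OF that]])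
    have "{x. y < ?h x} = (\<Union>f\<in>bl_ball. ?U f)"
      unfolding bl_dist_def using zero_in_bl_ball i
      by (subst less_cSUP_iff[OF _ bdd_above_bl_dist[OF prob_space_empirical_measure[OF n] \<nu>]])
        (auto simp: i)
    moreover have "open (?U f)" if "f \<in> bl_ball" for f
    proof (rule open_Collect_less)
      have "continuous_on UNIV (\<lambda>x :: nat \<Rightarrow> real. f (x i))" for i
        by (rule continuous_on_compose2[OF bl_ballD(1)[OF that]])
          (auto intro: continuous_on_product_coordinates)
      then show "continuous_on UNIV
          (\<lambda>x. \<bar>(\<Sum>i=1..n. f (x i)) / real n - (\<integral>x. f x \<partial>\<nu>)\<bar>)"
        using n by (intro continuous_intros) auto
    qed simp
    ultimately have "open {x. y < ?h x}" by auto
    then show "{x \<in> space borel. y < ?h x} \<in> sets borel" by simp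
  qed
  have "?h (\<lambda>i. X i \<omega>) = ?h (?Y \<omega>)" for \<omega>
  proof -
    have "(\<Sum>i=1..n. emeasure (return borel (X i \<omega>)) A)
        = (\<Sum>i=1..n. emeasure (return borel (?Y \<omega> i)) A)" for A
      by (rule sum.cong) auto
    then show ?thesis unfolding empirical_measure_def by presburger
  qed
  then show ?thesis using measurable_compose[OF Y h] by simp
qed

end

theory Submission
  imports Defs "HOL-Real_Asymp.Real_Asymp"
begin

text \<open>Write \<open>s = n / a2\<close>, \<open>x\<^sub>i = \<lambda>\<^sub>i / s\<close> and \<open>S(z) = 1/n * \<Sum>\<^sub>i 1 / (x\<^sub>i + z)\<close> for \<open>z > 0\<close>. The proof
  shows that the random Stieltjes transform \<open>S(z)\<close> nearly solves a deterministic quadratic equation,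
  with exponentially small failure probability, and that this forces weak convergence.

  Move all eigenvalues simultaneously by \<open>\<phi>(\<lambda>) = \<lambda> + t \<lambda> (1 - \<lambda>) / (\<lambda> + \<zeta>)\<close> with \<open>\<zeta> = s z\<close>. For small
  \<open>\<bar>t\<bar>\<close> this is an increasing bijection of \<open>[0,1]\<close>, so the change of variables formula shows that the
  likelihood ratio, density at \<open>\<phi>(\<lambda>)\<close> times Jacobian over density at \<open>\<lambda>\<close>, has expectation exactly 1
  (\<open>nn_integral_jacobi_deform\<close>). Every factor of the density changes by a factor \<open>1 + t q\<close> with a
  bounded \<open>q\<close>, also the Vandermonde factors, so the ratio is \<open>exp L\<close> with an explicit \<open>L\<close> and
  the singularities of the density at coinciding eigenvalues never have to be differentiated. For
  \<open>t = \<tau> s\<close>,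
  \<open>L = \<tau> n\<^sup>2 Q(S(z)) + o(\<tau> n\<^sup>2) + O(\<tau>\<^sup>2 n\<^sup>2)\<close> with
  \<open>Q(S) = \<beta>/2 z S\<^sup>2 + (\<beta>/(2\<gamma>) - \<beta>/2) S - (1 - z S)\<close> (\<open>log_ratio_expansion\<close>). The Vandermonde factors
  produce the quadratic term because the divided differences of \<open>\<lambda> / (\<lambda> + \<zeta>)\<close> factorize. Since
  \<open>exp L\<close> has mean 1, Markov's inequality for a small fixed \<open>\<tau>\<close> of either sign gives
  \<open>\<bar>Q(S(z))\<bar> \<le> \<kappa>\<close> outside an event of probability \<open>O(exp (- c n\<^sup>2))\<close> (\<open>jacobi_concentration\<close>).

  \<open>Q\<close> increases on \<open>[0,\<infinity>)\<close> with slope at least \<open>z\<close>, and its zero there is the Stieltjes transform of the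
  rescaled Marchenko--Pastur law, whose computation reduces to the single integral
  \<open>has_integral_sqrt_quadratic_over_x\<close>. Hence \<open>S(z)\<close> converges in probability to that transform.

  For probability measures on the half-line, convergence of the Stieltjes transforms at all \<open>z > 0\<close> gives
  convergence in the metric (locale \<open>stieltjes_limit\<close>): difference quotients in \<open>z\<close>
  give all powers of \<open>1 / (x + z)\<close>, the Weierstrass theorem in the variable \<open>1 / (x + 1)\<close> gives all
  continuous functions of compact support, and finitely many hat functions control all functions of the
  bounded Lipschitz unit ball at once. This argument runs along an arbitrary filter, and is
  applied to a filter on pairs \<open>(n, \<omega>)\<close> that encodes convergence in probability.\<close>

section \<open>Change of variables on a product of intervals\<close>

text \<open>Induction on the index set: the one-dimensional substitution is applied to the new coordinate, and the
  inner integral is then a function of the remaining coordinates.\<close>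

lemma nn_integral_PiM_substitution:
  fixes \<phi> \<phi>' :: "real \<Rightarrow> real"
  assumes "finite I" and "a < b"
    and deriv: "\<And>x. x \<in> {a..b} \<Longrightarrow> (\<phi> has_real_derivative \<phi>' x) (at x)"
    and cont: "continuous_on {a..b} \<phi>'"
    and nonneg: "\<And>x. x \<in> {a..b} \<Longrightarrow> 0 \<le> \<phi>' x"
    and [measurable]: "\<phi> \<in> borel_measurable borel" "\<phi>' \<in> borel_measurable borel"
    and "f \<in> borel_measurable (Pi\<^sub>M I (\<lambda>_. lborel))"
  shows "(\<integral>\<^sup>+x. f x * (\<Prod>i\<in>I. indicator {\<phi> a..\<phi> b} (x i)) \<partial>Pi\<^sub>M I (\<lambda>_. lborel)) =
         (\<integral>\<^sup>+x. f (\<lambda>i\<in>I. \<phi> (x i)) * (\<Prod>i\<in>I. ennreal (\<phi>' (x i)) * indicator {a..b} (x i))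
            \<partial>Pi\<^sub>M I (\<lambda>_. lborel))"
  using assms(1) assms(8)
proof (induction I arbitrary: f rule: finite_induct)
  case empty
  interpret product_sigma_finite "\<lambda>_. lborel :: real measure" by standard
  show ?case by (simp add: PiM_empty nn_integral_count_space_finite)
next
  case (insert i I)
  interpret product_sigma_finite "\<lambda>_. lborel :: real measure" by standard
  note [measurable] = insert.prems insert.hyps(1)
  let ?J = "indicator {\<phi> a..\<phi> b} :: real \<Rightarrow> ennreal"
  let ?K = "\<lambda>y. ennreal (\<phi>' y) * indicator {a..b} y"
  let ?P = "Pi\<^sub>M I (\<lambda>_. lborel :: real measure)"
  define F where "F x = (\<integral>\<^sup>+y. f (x(i := y)) * ?J y \<partial>lborel)" for x
  have F[measurable]: "F \<in> borel_measurable ?P"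
    unfolding F_def by measurable
  have F_eq: "F x = (\<integral>\<^sup>+y. f (x(i := \<phi> y)) * ?K y \<partial>lborel)" if "x \<in> space ?P" for x
  proof -
    have [measurable]: "(\<lambda>y. f (x(i := y))) \<in> borel_measurable borel"
      using that by measurable
    show ?thesis unfolding F_def
      by (subst nn_integral_substitution_aux[OF _ _ deriv cont nonneg \<open>a < b\<close>])
        (auto simp: mult.assoc)
  qed
  have ne: "j \<noteq> i" if "j \<in> I" for j using insert.hyps(2) that by auto
  have upd: "(\<lambda>j\<in>insert i I. \<phi> ((x(i := y)) j)) = (\<lambda>j\<in>I. \<phi> (x j))(i := \<phi> y)" for x y
    using insert.hyps(2) by (auto simp: fun_eq_iff restrict_def)
  have prod_upd: "(\<Prod>j\<in>I. g ((x(i := y)) j)) = (\<Prod>j\<in>I. g (x j))"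
    for g :: "real \<Rightarrow> ennreal" and x y
    by (rule prod.cong) (auto simp: ne)
  have "(\<integral>\<^sup>+x. f x * (\<Prod>j\<in>insert i I. ?J (x j)) \<partial>Pi\<^sub>M (insert i I) (\<lambda>_. lborel))
      = (\<integral>\<^sup>+x. \<integral>\<^sup>+y. (f (x(i := y)) * ?J y) * (\<Prod>j\<in>I. ?J (x j)) \<partial>lborel \<partial>?P)"
    using insert.hyps
    by (subst product_nn_integral_insert) (auto simp: prod_upd mult_ac fun_upd_same simp del: fun_upd_apply cong: nn_integral_cong)
  also have "\<dots> = (\<integral>\<^sup>+x. F x * (\<Prod>j\<in>I. ?J (x j)) \<partial>?P)"
    unfolding F_def
  proof (rule nn_integral_cong)
    fix x assume "x \<in> space ?P"
    then have [measurable]: "(\<lambda>y. f (x(i := y))) \<in> borel_measurable borel"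
      by measurable
    show "(\<integral>\<^sup>+y. (f (x(i := y)) * ?J y) * (\<Prod>j\<in>I. ?J (x j)) \<partial>lborel) =
      (\<integral>\<^sup>+y. f (x(i := y)) * ?J y \<partial>lborel) * (\<Prod>j\<in>I. ?J (x j))"
      by (rule nn_integral_multc) measurable
  qed
  also have "\<dots> = (\<integral>\<^sup>+x. F (\<lambda>j\<in>I. \<phi> (x j)) * (\<Prod>j\<in>I. ?K (x j)) \<partial>?P)"
    by (rule insert.IH) measurable
  also have "\<dots> = (\<integral>\<^sup>+x. (\<integral>\<^sup>+y. f ((\<lambda>j\<in>I. \<phi> (x j))(i := \<phi> y)) * ?K y * (\<Prod>j\<in>I. ?K (x j)) \<partial>lborel) \<partial>?P)"
  proof (rule nn_integral_cong)
    fix x assume "x \<in> space ?P"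
    have *: "(\<lambda>j\<in>I. \<phi> (x j)) \<in> space ?P" by (auto simp: space_PiM)
    then have [measurable]: "(\<lambda>y. f ((\<lambda>j\<in>I. \<phi> (x j))(i := y))) \<in> borel_measurable borel"
      by measurable
    show "F (\<lambda>j\<in>I. \<phi> (x j)) * (\<Prod>j\<in>I. ?K (x j)) =
      (\<integral>\<^sup>+y. f ((\<lambda>j\<in>I. \<phi> (x j))(i := \<phi> y)) * ?K y * (\<Prod>j\<in>I. ?K (x j)) \<partial>lborel)"
      unfolding F_eq[OF *] by (subst nn_integral_multc) measurable
  qed
  also have "\<dots> = (\<integral>\<^sup>+x. f (\<lambda>j\<in>insert i I. \<phi> (x j)) * (\<Prod>j\<in>insert i I. ?K (x j))
      \<partial>Pi\<^sub>M (insert i I) (\<lambda>_. lborel))"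
    using insert.hyps
    by (subst product_nn_integral_insert)
      (auto simp: prod_upd[of ?K] upd mult_ac fun_upd_same simp del: fun_upd_apply prod.insert_if cong: nn_integral_cong)
  finally show ?case .
qed

section \<open>A deformation of the cube and its likelihood ratio\<close>

text \<open>The divided difference of the vector field \<open>x (1 - x) / (x + \<zeta>)\<close>, and its derivative on the diagonal. The
  field vanishes at 0 and 1, so its flow preserves the unit interval, and its pole at \<open>- \<zeta>\<close> makes the
  divided difference an affine function of a product of two resolvents.\<close>

definition field_slope :: "real \<Rightarrow> real \<Rightarrow> real \<Rightarrow> real" where
  "field_slope \<zeta> x y = \<zeta> * (1 + \<zeta>) / ((x + \<zeta>) * (y + \<zeta>)) - 1"

definition deform :: "real \<Rightarrow> real \<Rightarrow> real \<Rightarrow> real" where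
  "deform \<zeta> t x = x + t * (x * (1 - x) / (x + \<zeta>))"

lemma deform_factors:
  assumes "0 < \<zeta>" "0 \<le> x" "0 \<le> y"
  shows "deform \<zeta> t x - deform \<zeta> t y = (x - y) * (1 + t * field_slope \<zeta> x y)"
    and "deform \<zeta> t x = x * (1 + t * ((1 - x) / (x + \<zeta>)))"
    and "1 - deform \<zeta> t x = (1 - x) * (1 + t * - (x / (x + \<zeta>)))"
proof -
  have p: "0 < x + \<zeta>" "0 < y + \<zeta>" using assms by auto
  have "x * (1 - x) / (x + \<zeta>) - y * (1 - y) / (y + \<zeta>)
      = (x * (1 - x) * (y + \<zeta>) - y * (1 - y) * (x + \<zeta>)) / ((x + \<zeta>) * (y + \<zeta>))"
    using p by (simp add: diff_frac_eq)
  also have "x * (1 - x) * (y + \<zeta>) - y * (1 - y) * (x + \<zeta>)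
      = (x - y) * (\<zeta> * (1 + \<zeta>) - (x + \<zeta>) * (y + \<zeta>))"
    by (simp add: algebra_simps)
  also have "\<dots> / ((x + \<zeta>) * (y + \<zeta>)) = (x - y) * field_slope \<zeta> x y"
    using p by (simp add: field_slope_def diff_divide_distrib right_diff_distrib)
  finally have "x * (1 - x) / (x + \<zeta>) - y * (1 - y) / (y + \<zeta>) = (x - y) * field_slope \<zeta> x y" .
  then have "t * (x * (1 - x) / (x + \<zeta>)) - t * (y * (1 - y) / (y + \<zeta>)) = t * ((x - y) * field_slope \<zeta> x y)"
    by (simp only: right_diff_distrib[symmetric])
  then show "deform \<zeta> t x - deform \<zeta> t y = (x - y) * (1 + t * field_slope \<zeta> x y)"
    by (simp add: deform_def algebra_simps)
  show "deform \<zeta> t x = x * (1 + t * ((1 - x) / (x + \<zeta>)))"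
    by (simp add: deform_def algebra_simps)
  show "1 - deform \<zeta> t x = (1 - x) * (1 + t * - (x / (x + \<zeta>)))"
    using p by (simp add: deform_def field_simps)
qed

lemma field_slope_bound:
  assumes "0 < \<zeta>" "0 \<le> x" "0 \<le> y"
  shows "\<bar>field_slope \<zeta> x y\<bar> \<le> 1 + 1 / \<zeta>"
proof -
  have "\<zeta> * \<zeta> \<le> (x + \<zeta>) * (y + \<zeta>)" using assms by (intro mult_mono) auto
  then have "\<zeta> * (1 + \<zeta>) / ((x + \<zeta>) * (y + \<zeta>)) \<le> \<zeta> * (1 + \<zeta>) / (\<zeta> * \<zeta>)"
    using assms by (intro divide_left_mono) auto
  also have "\<dots> = 1 + 1 / \<zeta>" using assms by (simp add: field_simps)
  finally have "field_slope \<zeta> x y \<le> 1 / \<zeta>" by (simp add: field_slope_def)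
  moreover have "-1 \<le> field_slope \<zeta> x y" using assms by (simp add: field_slope_def)
  moreover have "0 < 1 / \<zeta>" using assms by simp
  ultimately show ?thesis by linarith
qed

text \<open>The three relative changes that occur when all points are moved: of a difference of two points (and of
  the length element), of a point, and of its distance to 1. They stay in the region where the logarithm
  is close to its linearization.\<close>

lemma deform_slopes:
  assumes "0 < \<zeta>" "\<bar>t\<bar> * (1 + 1 / \<zeta>) \<le> 1 / 2" "x \<in> {0..1}" "y \<in> {0..1}"
  shows "\<bar>t * field_slope \<zeta> x y\<bar> \<le> 1 / 2" "\<bar>t * ((1 - x) / (x + \<zeta>))\<bar> \<le> 1 / 2" "\<bar>t * - (x / (x + \<zeta>))\<bar> \<le> 1 / 2"
proof -
  have *: "\<bar>t * c\<bar> \<le> 1 / 2" if "\<bar>c\<bar> \<le> 1 + 1 / \<zeta>" for c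
    using order_trans[OF mult_left_mono[OF that abs_ge_zero] assms(2)] by (simp add: abs_mult)
  show "\<bar>t * field_slope \<zeta> x y\<bar> \<le> 1 / 2"
    using field_slope_bound assms by (intro *) auto
  have "(1 - x) / (x + \<zeta>) \<le> 1 / \<zeta>" using assms by (intro frac_le) auto
  then show "\<bar>t * ((1 - x) / (x + \<zeta>))\<bar> \<le> 1 / 2" using assms by (intro *) auto
  have "0 \<le> x / (x + \<zeta>)" "x / (x + \<zeta>) \<le> 1" "0 < 1 / \<zeta>" using assms by auto
  then have "\<bar>- (x / (x + \<zeta>))\<bar> \<le> 1 + 1 / \<zeta>" by linarith
  then show "\<bar>t * - (x / (x + \<zeta>))\<bar> \<le> 1 / 2" by (rule *)
qed

definition pairs :: "nat \<Rightarrow> (nat \<times> nat) set" where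
  "pairs n = {(i, j). 1 \<le> i \<and> i < j \<and> j \<le> n}"

lemma finite_pairs [simp]: "finite (pairs n)"
  by (rule finite_subset[of _ "{1..n} \<times> {1..n}"]) (auto simp: pairs_def)

text \<open>The logarithm of (density at the moved points) times (Jacobian) over (density at the original points),
  where \<open>b1\<close> and \<open>b2\<close> are the exponents of \<open>\<lambda>\<^sub>i\<close> and \<open>1 - \<lambda>\<^sub>i\<close> in the density.\<close>

definition log_ratio :: "nat \<Rightarrow> real \<Rightarrow> real \<Rightarrow> real \<Rightarrow> real \<Rightarrow> real \<Rightarrow> (nat \<Rightarrow> real) \<Rightarrow> real" where
  "log_ratio n \<beta> b1 b2 \<zeta> t l =
     (\<Sum>(i, j)\<in>pairs n. \<beta> * ln (1 + t * field_slope \<zeta> (l i) (l j)))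
     + (\<Sum>i=1..n. b1 * ln (1 + t * ((1 - l i) / (l i + \<zeta>))) + b2 * ln (1 + t * - (l i / (l i + \<zeta>)))
          + ln (1 + t * field_slope \<zeta> (l i) (l i)))"

abbreviation jacobi_p :: "nat \<Rightarrow> real \<Rightarrow> real" where
  "jacobi_p n \<beta> \<equiv> 1 + \<beta> / 2 * (real n - 1)"

lemma deform_unit:
  assumes "0 < \<zeta>" "\<bar>t\<bar> * (1 + 1 / \<zeta>) \<le> 1 / 2" "x \<in> {0..1}"
  shows "deform \<zeta> t x \<in> {0..1}"
proof -
  note s = deform_slopes[OF assms(1,2,3) assms(3)]
  have "0 \<le> 1 + t * ((1 - x) / (x + \<zeta>))" "0 \<le> 1 + t * - (x / (x + \<zeta>))"
    using s(2,3) by linarith+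
  then have "0 \<le> x * (1 + t * ((1 - x) / (x + \<zeta>)))" "0 \<le> (1 - x) * (1 + t * - (x / (x + \<zeta>)))"
    using assms(3) by (intro mult_nonneg_nonneg; simp)+
  then have "0 \<le> deform \<zeta> t x" "0 \<le> 1 - deform \<zeta> t x"
    using assms(3) deform_factors(2,3)[OF assms(1), of x x t] by (simp_all only: atLeastAtMost_iff)
  then show ?thesis by simp
qed

text \<open>All factors of the density are real powers of quantities that the deformation multiplies by factors of the
  form \<open>1 + t q\<close>; real powers are multiplicative, also at base 0, so coinciding or extreme points need no
  separate treatment.\<close>

lemma jacobi_density_deform:
  assumes "0 < \<zeta>" "\<bar>t\<bar> * (1 + 1 / \<zeta>) \<le> 1 / 2" "\<forall>i\<in>{1..n}. l i \<in> {0..1}"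
  shows "jacobi_density n \<beta> a1 a2 (\<lambda>i\<in>{1..n}. deform \<zeta> t (l i)) * (\<Prod>i=1..n. 1 + t * field_slope \<zeta> (l i) (l i))
       = jacobi_density n \<beta> a1 a2 l * exp (log_ratio n \<beta> (a1 - jacobi_p n \<beta>) (a2 - jacobi_p n \<beta>) \<zeta> t l)"
proof -
  let ?p = "jacobi_p n \<beta>" and ?l' = "\<lambda>i\<in>{1..n}. deform \<zeta> t (l i)"
  note s = deform_slopes[OF assms(1,2)]
  have l: "l i \<in> {0..1}" if "i \<in> {1..n}" for i using assms(3) that by blast
  have powr_exp: "(1 + y) powr e = exp (e * ln (1 + y))" if "\<bar>y\<bar> \<le> 1 / 2" for y e :: real
    using that by (auto simp: powr_def abs_if split: if_splits)
  have cube': "\<forall>i\<in>{1..n}. ?l' i \<in> {0..1}" using deform_unit[OF assms(1,2)] l by simp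
  have pair: "(\<Prod>(i, j)\<in>pairs n. \<bar>?l' i - ?l' j\<bar> powr \<beta>)
      = (\<Prod>(i, j)\<in>pairs n. \<bar>l i - l j\<bar> powr \<beta>)
        * exp (\<Sum>(i, j)\<in>pairs n. \<beta> * ln (1 + t * field_slope \<zeta> (l i) (l j)))"
    unfolding exp_sum[OF finite_pairs] prod.distrib[symmetric]
  proof (rule prod.cong[OF refl], clarify)
    fix i j assume "(i, j) \<in> pairs n"
    then have ij: "i \<in> {1..n}" "j \<in> {1..n}" by (auto simp: pairs_def)
    note b = s(1)[OF l[OF ij(1)] l[OF ij(2)]]
    have pos: "0 \<le> 1 + t * field_slope \<zeta> (l i) (l j)" using b by (auto simp: abs_if split: if_splits)
    have "\<bar>?l' i - ?l' j\<bar> = \<bar>(l i - l j) * (1 + t * field_slope \<zeta> (l i) (l j))\<bar>"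
      using ij l[OF ij(1)] l[OF ij(2)] deform_factors(1)[OF assms(1)] by simp
    also have "\<dots> = \<bar>l i - l j\<bar> * (1 + t * field_slope \<zeta> (l i) (l j))"
      using pos by (simp add: abs_mult)
    finally show "\<bar>?l' i - ?l' j\<bar> powr \<beta> = \<bar>l i - l j\<bar> powr \<beta> * exp (\<beta> * ln (1 + t * field_slope \<zeta> (l i) (l j)))"
      using pos by (simp add: powr_mult powr_exp[OF b])
  qed
  have single: "(\<Prod>i=1..n. ?l' i powr (a1 - ?p) * (1 - ?l' i) powr (a2 - ?p)) * (\<Prod>i=1..n. 1 + t * field_slope \<zeta> (l i) (l i))
      = (\<Prod>i=1..n. l i powr (a1 - ?p) * (1 - l i) powr (a2 - ?p))
       * exp (\<Sum>i=1..n. (a1 - ?p) * ln (1 + t * ((1 - l i) / (l i + \<zeta>)))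
            + (a2 - ?p) * ln (1 + t * - (l i / (l i + \<zeta>))) + ln (1 + t * field_slope \<zeta> (l i) (l i)))"
    unfolding exp_sum[OF finite_atLeastAtMost] prod.distrib[symmetric]
  proof (rule prod.cong[OF refl])
    fix i assume i: "i \<in> {1..n}"
    note b = s[OF l[OF i] l[OF i]]
    have 1: "?l' i = l i * (1 + t * ((1 - l i) / (l i + \<zeta>)))"
      using i l[OF i] deform_factors(2)[OF assms(1), of "l i" "l i" t] by simp
    have 2: "1 - ?l' i = (1 - l i) * (1 + t * - (l i / (l i + \<zeta>)))"
      using i l[OF i] deform_factors(3)[OF assms(1), of "l i" "l i" t] by simp
    have "?l' i powr (a1 - ?p) = l i powr (a1 - ?p) * (1 + t * ((1 - l i) / (l i + \<zeta>))) powr (a1 - ?p)"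
      unfolding 1 by (rule powr_mult)
    moreover have "(1 - ?l' i) powr (a2 - ?p) = (1 - l i) powr (a2 - ?p) * (1 + t * - (l i / (l i + \<zeta>))) powr (a2 - ?p)"
      unfolding 2 by (rule powr_mult)
    moreover have "1 + t * field_slope \<zeta> (l i) (l i) = exp (ln (1 + t * field_slope \<zeta> (l i) (l i)))"
      using b(1) by (subst exp_ln) (auto simp: abs_if split: if_splits)
    ultimately show "?l' i powr (a1 - ?p) * (1 - ?l' i) powr (a2 - ?p) * (1 + t * field_slope \<zeta> (l i) (l i))
       = l i powr (a1 - ?p) * (1 - l i) powr (a2 - ?p) *
         exp ((a1 - ?p) * ln (1 + t * ((1 - l i) / (l i + \<zeta>)))
            + (a2 - ?p) * ln (1 + t * - (l i / (l i + \<zeta>))) + ln (1 + t * field_slope \<zeta> (l i) (l i)))"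
      unfolding exp_add by (simp only: powr_exp[OF b(2)] powr_exp[OF b(3)] mult_ac)
  qed
  have "jacobi_density n \<beta> a1 a2 ?l' * (\<Prod>i=1..n. 1 + t * field_slope \<zeta> (l i) (l i))
     = jacobi_const n \<beta> a1 a2 * (\<Prod>(i, j)\<in>pairs n. \<bar>?l' i - ?l' j\<bar> powr \<beta>)
        * ((\<Prod>i=1..n. ?l' i powr (a1 - ?p) * (1 - ?l' i) powr (a2 - ?p)) * (\<Prod>i=1..n. 1 + t * field_slope \<zeta> (l i) (l i)))"
    by (simp only: jacobi_density_def Let_def pairs_def[symmetric] if_P[OF cube'] mult.assoc)
  also have "\<dots> = jacobi_density n \<beta> a1 a2 l * exp (log_ratio n \<beta> (a1 - ?p) (a2 - ?p) \<zeta> t l)"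
    unfolding pair single
    by (simp only: jacobi_density_def Let_def pairs_def[symmetric] log_ratio_def exp_add if_P[OF assms(3)] mult_ac)
  finally show ?thesis .
qed

lemma borel_measurable_log_ratio [measurable]:
  "log_ratio n \<beta> b1 b2 \<zeta> t \<in> borel_measurable (Pi\<^sub>M {1..n} (\<lambda>_. lborel))"
proof -

  have 1: "(\<lambda>l. case e of (i, j) \<Rightarrow> \<beta> * ln (1 + t * field_slope \<zeta> (l i) (l j))) \<in> borel_measurable (Pi\<^sub>M {1..n} (\<lambda>_. lborel))"
    if "e \<in> pairs n" for e
  proof -
    obtain i j where e: "e = (i, j)" by force
    have "i \<in> {1..n}" "j \<in> {1..n}" using that by (auto simp: e pairs_def)
    then show ?thesis unfolding e field_slope_def prod.case by measurable
  qed
  have 2: "(\<lambda>l. b1 * ln (1 + t * ((1 - l i) / (l i + \<zeta>))) + b2 * ln (1 + t * - (l i / (l i + \<zeta>)))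
          + ln (1 + t * field_slope \<zeta> (l i) (l i))) \<in> borel_measurable (Pi\<^sub>M {1..n} (\<lambda>_. lborel))"
    if "i \<in> {1..n}" for i
    unfolding field_slope_def using that by measurable
  show ?thesis
    unfolding log_ratio_def[abs_def]
    by (intro borel_measurable_add borel_measurable_sum 1 2)
qed

text \<open>An exact form of the loop equations: instead of integrating by parts, which would need derivatives of
  \<open>\<bar>\<lambda>\<^sub>i - \<lambda>\<^sub>j\<bar> powr \<beta>\<close>, the total mass is compared before and after a finite deformation.\<close>

lemma nn_integral_jacobi_deform:
  assumes "0 < \<zeta>" "\<bar>t\<bar> * (1 + 1 / \<zeta>) \<le> 1 / 2"
    and meas: "(\<lambda>l. ennreal (jacobi_density n \<beta> a1 a2 l)) \<in> borel_measurable (Pi\<^sub>M {1..n} (\<lambda>_. lborel))"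
  shows "(\<integral>\<^sup>+l. ennreal (jacobi_density n \<beta> a1 a2 l)
            * ennreal (exp (log_ratio n \<beta> (a1 - jacobi_p n \<beta>) (a2 - jacobi_p n \<beta>) \<zeta> t l)) \<partial>Pi\<^sub>M {1..n} (\<lambda>_. lborel))
       = (\<integral>\<^sup>+l. ennreal (jacobi_density n \<beta> a1 a2 l) \<partial>Pi\<^sub>M {1..n} (\<lambda>_. lborel))"
proof -
  let ?\<rho> = "\<lambda>l. jacobi_density n \<beta> a1 a2 l" and ?P = "Pi\<^sub>M {1..n} (\<lambda>_. lborel :: real measure)"
  let ?L = "log_ratio n \<beta> (a1 - jacobi_p n \<beta>) (a2 - jacobi_p n \<beta>) \<zeta> t"
  let ?\<phi> = "deform \<zeta> t" and ?\<phi>' = "\<lambda>x. 1 + t * field_slope \<zeta> x x"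
  have ends: "?\<phi> 0 = 0" "?\<phi> 1 = 1" by (simp_all add: deform_def)
  have prod_ind: "(\<Prod>i\<in>{1..n}. indicator {0..1} (l i)) = (if \<forall>i\<in>{1..n}. l i \<in> {0..1} then 1 else (0::ennreal))"
    for l :: "nat \<Rightarrow> real" by (auto simp: indicator_def)
  have out: "?\<rho> l = 0" if "\<not> (\<forall>i\<in>{1..n}. l i \<in> {0..1})" for l
    using that unfolding jacobi_density_def Let_def by (rule if_not_P)
  have "(\<integral>\<^sup>+l. ennreal (?\<rho> l) \<partial>?P) = (\<integral>\<^sup>+l. ennreal (?\<rho> l) * (\<Prod>i\<in>{1..n}. indicator {?\<phi> 0..?\<phi> 1} (l i)) \<partial>?P)"
    unfolding ends prod_ind by (rule nn_integral_cong) (auto simp: out)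
  also have "\<dots> = (\<integral>\<^sup>+l. ennreal (?\<rho> (\<lambda>i\<in>{1..n}. ?\<phi> (l i)))
      * (\<Prod>i\<in>{1..n}. ennreal (?\<phi>' (l i)) * indicator {0..1} (l i)) \<partial>?P)"
  proof (rule nn_integral_PiM_substitution[where f = "\<lambda>l. ennreal (?\<rho> l)"])
    show "(?\<phi> has_real_derivative ?\<phi>' x) (at x)" if "x \<in> {0..1}" for x
    proof -
      have p: "x + \<zeta> \<noteq> 0" using that assms(1) by auto
      have "((1 - 2 * x) * (x + \<zeta>) - x * (1 - x)) / ((x + \<zeta>) * (x + \<zeta>)) = field_slope \<zeta> x x"
        using p by (simp add: field_slope_def divide_simps) (simp add: algebra_simps)
      moreover have "((\<lambda>x. x * (1 - x) / (x + \<zeta>)) has_real_derivative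
          ((1 - 2 * x) * (x + \<zeta>) - x * (1 - x)) / ((x + \<zeta>) * (x + \<zeta>))) (at x)"
        using p by (auto intro!: derivative_eq_intros simp: algebra_simps)
      ultimately show ?thesis
        unfolding deform_def by (intro DERIV_add DERIV_ident DERIV_cmult) simp
    qed
    show "continuous_on {0..1} ?\<phi>'"
      unfolding field_slope_def using assms(1) by (intro continuous_intros) auto
    show "0 \<le> ?\<phi>' x" if "x \<in> {0..1}" for x
      using deform_slopes(1)[OF assms(1,2) that that] by (auto simp: abs_if split: if_splits)
  qed (use meas in \<open>simp_all add: deform_def[abs_def] field_slope_def[abs_def]\<close>)
  also have "\<dots> = (\<integral>\<^sup>+l. ennreal (?\<rho> l) * ennreal (exp (?L l)) \<partial>?P)"
  proof (rule nn_integral_cong)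
    fix l :: "nat \<Rightarrow> real"
    show "ennreal (?\<rho> (\<lambda>i\<in>{1..n}. ?\<phi> (l i))) * (\<Prod>i\<in>{1..n}. ennreal (?\<phi>' (l i)) * indicator {0..1} (l i))
        = ennreal (?\<rho> l) * ennreal (exp (?L l))"
    proof (cases "\<forall>i\<in>{1..n}. l i \<in> {0..1}")
      case True
      have nn: "0 \<le> ?\<phi>' (l i)" if "i \<in> {1..n}" for i
        using deform_slopes(1)[OF assms(1,2), of "l i" "l i"] True that by (auto simp: abs_if split: if_splits)
      have "(\<Prod>i\<in>{1..n}. ennreal (?\<phi>' (l i)) * indicator {0..1} (l i)) = ennreal (\<Prod>i\<in>{1..n}. ?\<phi>' (l i))"
        unfolding prod.distrib prod_ind if_P[OF True] mult_1_right by (rule prod_ennreal[OF nn])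
      moreover have "0 \<le> (\<Prod>i\<in>{1..n}. ?\<phi>' (l i))" using nn by (rule prod_nonneg)
      ultimately show ?thesis
        by (simp only: ennreal_mult''[symmetric] exp_ge_zero jacobi_density_deform[OF assms(1,2) True])
    next
      case False
      show ?thesis
        unfolding prod.distrib prod_ind if_not_P[OF False] out[OF False] by simp
    qed
  qed
  finally show ?thesis by simp
qed

section \<open>The Marchenko--Pastur law and its Stieltjes transform\<close>

text \<open>With \<open>R = (x - a) (b - x)\<close>, an antiderivative is
  \<open>sqrt R + (a + b)/2 arcsin u - sqrt (a b) arcsin v\<close>, where \<open>u\<close> and \<open>v\<close> are the affine and the Moebius
  reparametrization of \<open>[a, b]\<close> by \<open>[-1, 1]\<close>; the derivatives of the three summands add up to
  \<open>((a + b) x - x\<^sup>2 - a b) / (x sqrt R) = sqrt R / x\<close>.\<close>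

lemma has_integral_sqrt_quadratic_over_x:
  fixes a b :: real
  assumes "0 \<le> a" "a < b"
  shows "((\<lambda>x. sqrt ((x - a) * (b - x)) / x) has_integral pi * ((a + b) / 2 - sqrt (a * b))) {a..b}"
proof -
  define u where "u x = (2 * x - a - b) / (b - a)" for x
  define v where "v x = ((a + b) * x - 2 * a * b) / (x * (b - a))" for x
  define F where "F x = sqrt ((x - a) * (b - x)) + (a + b) / 2 * arcsin (u x)
                        - sqrt (a * b) * arcsin (v x)" for x
  have u_sq: "1 - (u x)\<^sup>2 = 4 * ((x - a) * (b - x)) / (b - a)\<^sup>2" for x
  proof -
    have "(b - a)\<^sup>2 \<noteq> 0" using assms by simp
    moreover have "(b - a)\<^sup>2 - (2 * x - a - b)\<^sup>2 = 4 * ((x - a) * (b - x))"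
      by (simp add: algebra_simps power2_eq_square)
    ultimately show ?thesis
      unfolding u_def power_divide by (simp add: divide_simps)
  qed
  have v_sq: "1 - (v x)\<^sup>2 = 4 * (a * b) * ((x - a) * (b - x)) / (x * (b - a))\<^sup>2" if "x \<noteq> 0" for x
  proof -
    have "(x * (b - a))\<^sup>2 \<noteq> 0" using that assms by simp
    moreover have "(x * (b - a))\<^sup>2 - ((a + b) * x - 2 * a * b)\<^sup>2 = 4 * (a * b) * ((x - a) * (b - x))"
      by (simp add: algebra_simps power2_eq_square)
    ultimately show ?thesis
      unfolding v_def power_divide by (simp add: diff_divide_distrib[symmetric] divide_simps)
  qed
  have u_bd: "-1 \<le> u x \<and> u x \<le> 1" if "x \<in> {a..b}" for x
    using that assms unfolding u_def by (simp add: field_simps)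
  have v_bd: "-1 \<le> v x \<and> v x \<le> 1" if "x \<in> {a..b}" "x \<noteq> 0" for x
  proof -
    have "0 \<le> 1 - (v x)\<^sup>2"
      unfolding v_sq[OF that(2)] using that assms by (intro divide_nonneg_nonneg mult_nonneg_nonneg) auto
    then have "\<bar>v x\<bar> \<le> 1" by (simp add: abs_square_le_1)
    then show ?thesis by linarith
  qed
  \<comment> \<open>For \<open>a = 0\<close> the last summand is 0, whatever \<open>v\<close> is at the end point \<open>x = 0\<close>.\<close>
  have contv: "continuous_on {a..b} (\<lambda>x. sqrt (a * b) * arcsin (v x))"
  proof (cases "a = 0")
    case False
    then have "continuous_on {a..b} v"
      unfolding v_def using assms by (intro continuous_intros) auto
    then show ?thesis using v_bd False assms by (intro continuous_intros) auto
  qed simp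
  have contF: "continuous_on {a..b} F"
    unfolding F_def using u_bd assms
    by (intro continuous_on_add continuous_on_diff contv continuous_on_mult continuous_on_const
        continuous_on_arcsin continuous_on_real_sqrt)
      (auto simp: u_def intro!: continuous_intros)
  have derF: "(F has_vector_derivative (sqrt ((x - a) * (b - x)) / x)) (at x)"
    if x: "x \<in> {a<..<b}" for x
  proof -
    define R where "R = (x - a) * (b - x)"
    have pos: "0 < x" "0 < R" "0 < b - a" using x assms by (auto simp: R_def)
    have du: "(u has_real_derivative 2 / (b - a)) (at x)"
      unfolding u_def by (rule DERIV_cdivide) (auto intro!: derivative_eq_intros)
    have dv: "(v has_real_derivative 2 * a * b / (x\<^sup>2 * (b - a))) (at x)"
    proof -
      have "(v has_real_derivative ((a + b) * (x * (b - a)) - ((a + b) * x - 2 * a * b) * (b - a))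
              / ((x * (b - a)) * (x * (b - a)))) (at x)"
        unfolding v_def using pos by (auto intro!: derivative_eq_intros)
      also have "(a + b) * (x * (b - a)) - ((a + b) * x - 2 * a * b) * (b - a) = 2 * a * b * (b - a)"
        by (simp add: algebra_simps)
      also have "2 * a * b * (b - a) / ((x * (b - a)) * (x * (b - a))) = 2 * a * b / (x\<^sup>2 * (b - a))"
        using pos by (simp add: power2_eq_square)
      finally show ?thesis .
    qed
    have su: "sqrt (1 - (u x)\<^sup>2) = 2 * sqrt R / (b - a)"
      unfolding u_sq R_def[symmetric] using pos by (simp add: real_sqrt_divide real_sqrt_mult)
    have u1: "-1 < u x" "u x < 1"
      using x assms unfolding u_def by (simp_all add: field_simps)
    have dU: "((\<lambda>x. arcsin (u x)) has_real_derivative 1 / sqrt R) (at x)"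
    proof -
      have "inverse (2 * sqrt R / (b - a)) * (2 / (b - a)) = 1 / sqrt R" using pos by (simp add: divide_simps)
      then show ?thesis using DERIV_chain2[OF DERIV_arcsin[OF u1] du] by (simp only: su)
    qed
    have dV: "((\<lambda>x. sqrt (a * b) * arcsin (v x)) has_real_derivative a * b / (x * sqrt R)) (at x)"
    proof (cases "a = 0")
      case False
      then have ab: "0 < a * b" using assms by simp
      have sv: "sqrt (1 - (v x)\<^sup>2) = 2 * sqrt (a * b) * sqrt R / (x * (b - a))"
        using v_sq[of x] pos by (simp add: R_def[symmetric] real_sqrt_divide real_sqrt_mult)
      have "0 < 1 - (v x)\<^sup>2"
        using v_sq[of x] pos ab by (simp add: R_def[symmetric])
      then have "\<bar>v x\<bar> < 1" by (simp add: abs_square_less_1)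
      then have v1: "-1 < v x" "v x < 1" by linarith+
      have "sqrt (a * b) * (inverse (sqrt (1 - (v x)\<^sup>2)) * (2 * a * b / (x\<^sup>2 * (b - a))))
          = a * b / (x * sqrt R)"
        unfolding sv using pos ab by (simp add: divide_simps power2_eq_square)
      then show ?thesis
        using DERIV_cmult[OF DERIV_chain2[OF DERIV_arcsin[OF v1] dv], of "sqrt (a * b)"]
        by simp
    qed simp
    have dS: "((\<lambda>x. sqrt ((x - a) * (b - x))) has_real_derivative (a + b - 2 * x) / (2 * sqrt R)) (at x)"
      using pos(2) unfolding R_def by (auto intro!: derivative_eq_intros simp: field_simps)
    have "(F has_real_derivative ((a + b - 2 * x) / (2 * sqrt R) + (a + b) / 2 * (1 / sqrt R)
              - a * b / (x * sqrt R))) (at x)"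
      unfolding F_def by (intro DERIV_add DERIV_diff DERIV_cmult dS dU dV)
    also have "(a + b - 2 * x) / (2 * sqrt R) + (a + b) / 2 * (1 / sqrt R) - a * b / (x * sqrt R)
        = ((a + b) * x - x * x - a * b) / (x * sqrt R)"
      using pos by (simp add: field_simps)
    also have "(a + b) * x - x * x - a * b = sqrt R * sqrt R"
      using pos by (simp add: R_def algebra_simps)
    also have "sqrt R * sqrt R / (x * sqrt R) = sqrt R / x" using pos by (simp del: real_sqrt_mult_self)
    finally show ?thesis
      by (simp add: has_real_derivative_iff_has_vector_derivative R_def)
  qed
  have ua: "u a = -1" "u b = 1" using assms by (simp_all add: u_def field_simps)
  have va: "sqrt (a * b) * arcsin (v a) = - sqrt (a * b) * (pi / 2)"
           "sqrt (a * b) * arcsin (v b) = sqrt (a * b) * (pi / 2)"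
  proof -
    have "v a = -1" if "a \<noteq> 0"
    proof -
      have "(a + b) * a - 2 * a * b = - (a * (b - a))" by (simp add: algebra_simps)
      then show ?thesis using that assms by (simp add: v_def)
    qed
    moreover have "v b = 1"
    proof -
      have "(a + b) * b - 2 * a * b = b * (b - a)" by (simp add: algebra_simps)
      then show ?thesis using assms by (simp add: v_def)
    qed
    ultimately show "sqrt (a * b) * arcsin (v a) = - sqrt (a * b) * (pi / 2)"
           "sqrt (a * b) * arcsin (v b) = sqrt (a * b) * (pi / 2)"
      by (cases "a = 0"; simp)+
  qed
  have "F b - F a = pi * ((a + b) / 2 - sqrt (a * b))"
  proof -
    have "F b - F a = (a + b) / 2 * pi - (sqrt (a * b) * arcsin (v b) - sqrt (a * b) * arcsin (v a))"
      unfolding F_def ua by (simp add: algebra_simps)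
    then show ?thesis unfolding va by (simp add: algebra_simps)
  qed
  then show ?thesis
    using fundamental_theorem_of_calculus_interior[OF _ contF derF] assms by simp
qed

text \<open>The positive root \<open>m\<close> of \<open>\<gamma> z m\<^sup>2 + (z + 1 - \<gamma>) m - 1 = 0\<close>.\<close>

definition mp_stieltjes :: "real \<Rightarrow> real \<Rightarrow> real" where
  "mp_stieltjes \<gamma> z = (sqrt ((z + 1 - \<gamma>)\<^sup>2 + 4 * \<gamma> * z) - (z + 1 - \<gamma>)) / (2 * \<gamma> * z)"

lemma mp_edges:
  fixes \<gamma> :: real
  assumes "0 < \<gamma>"
  shows "0 \<le> (sqrt \<gamma> - 1)\<^sup>2" "(sqrt \<gamma> - 1)\<^sup>2 < (sqrt \<gamma> + 1)\<^sup>2"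
    "(sqrt \<gamma> - 1)\<^sup>2 + (sqrt \<gamma> + 1)\<^sup>2 = 2 * (1 + \<gamma>)"
    "(sqrt \<gamma> - 1)\<^sup>2 * (sqrt \<gamma> + 1)\<^sup>2 = (1 - \<gamma>)\<^sup>2"
proof -
  have g: "sqrt \<gamma> * sqrt \<gamma> = \<gamma>" "0 < sqrt \<gamma>" using assms by auto
  show "0 \<le> (sqrt \<gamma> - 1)\<^sup>2" by simp
  show "(sqrt \<gamma> - 1)\<^sup>2 < (sqrt \<gamma> + 1)\<^sup>2" using g by (simp add: power2_eq_square algebra_simps)
  show "(sqrt \<gamma> - 1)\<^sup>2 + (sqrt \<gamma> + 1)\<^sup>2 = 2 * (1 + \<gamma>)"
    using g by (simp add: power2_eq_square algebra_simps)
  have "(sqrt \<gamma> - 1)\<^sup>2 * (sqrt \<gamma> + 1)\<^sup>2 = ((sqrt \<gamma> - 1) * (sqrt \<gamma> + 1))\<^sup>2"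
    by (simp add: power_mult_distrib)
  also have "(sqrt \<gamma> - 1) * (sqrt \<gamma> + 1) = \<gamma> - 1" using g by (simp add: algebra_simps)
  finally show "(sqrt \<gamma> - 1)\<^sup>2 * (sqrt \<gamma> + 1)\<^sup>2 = (1 - \<gamma>)\<^sup>2" by (simp add: power2_commute)
qed

text \<open>A translation by \<open>w\<close> reduces this to the case of the weight \<open>1 / x\<close>; the square root is
  \<open>sqrt ((a + w) (b + w))\<close>.\<close>

lemma has_integral_mp_weight:
  fixes \<gamma> w :: real
  assumes "0 < \<gamma>" "0 \<le> w"
  defines "a \<equiv> (sqrt \<gamma> - 1)\<^sup>2" and "b \<equiv> (sqrt \<gamma> + 1)\<^sup>2"
  shows "((\<lambda>x. sqrt ((x - a) * (b - x)) / (x + w)) has_integral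
           pi * (1 + \<gamma> + w - sqrt ((w + 1 - \<gamma>)\<^sup>2 + 4 * \<gamma> * w))) {a..b}"
proof -
  note e = mp_edges[OF assms(1), folded a_def b_def]
  have "((\<lambda>x. sqrt ((x - (a + w)) * ((b + w) - x)) / x) has_integral
          pi * (((a + w) + (b + w)) / 2 - sqrt ((a + w) * (b + w)))) {a + w..b + w}"
    using e assms(2) by (intro has_integral_sqrt_quadratic_over_x) auto
  then have "((\<lambda>x. sqrt ((x - a) * (b - x)) / (x + w)) has_integral
          pi * (((a + w) + (b + w)) / 2 - sqrt ((a + w) * (b + w)))) {a..b}"
    by (simp add: has_integral_shift_Icc_real[symmetric] o_def add.commute)
  also have "((a + w) + (b + w)) / 2 = 1 + \<gamma> + w" using e by (simp add: field_simps)
  also have "(a + w) * (b + w) = a * b + (a + b) * w + w\<^sup>2" by (simp add: algebra_simps power2_eq_square)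
  also have "\<dots> = (w + 1 - \<gamma>)\<^sup>2 + 4 * \<gamma> * w" unfolding e by (simp add: algebra_simps power2_eq_square)
  finally show ?thesis .
qed

lemma mp_density_nonneg:
  assumes "0 < \<gamma>"
  shows "0 \<le> mp_density \<gamma> x"
proof (cases "x \<in> {(sqrt \<gamma> - 1)\<^sup>2..(sqrt \<gamma> + 1)\<^sup>2}")
  case True
  then have "0 \<le> x" using order_trans[OF zero_le_power2, of "sqrt \<gamma> - 1" x] by simp
  then show ?thesis using True assms by (simp add: mp_density_def Let_def)
qed (auto simp: mp_density_def Let_def)

lemma mp_density_eq_0:
  assumes "0 < \<gamma>" "x < 0"
  shows "mp_density \<gamma> x = 0"
proof -
  have "x \<notin> {(sqrt \<gamma> - 1)\<^sup>2..(sqrt \<gamma> + 1)\<^sup>2}"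
    using assms(2) order_trans[OF zero_le_power2, of "sqrt \<gamma> - 1" x] by auto
  then show ?thesis unfolding mp_density_def Let_def by (rule if_not_P)
qed

lemma borel_measurable_mp_density [measurable]: "mp_density \<gamma> \<in> borel_measurable borel"
  unfolding mp_density_def Let_def by measurable

text \<open>At \<open>w = 0\<close> the square root in \<open>has_integral_mp_weight\<close> is \<open>\<bar>1 - \<gamma>\<bar>\<close>, which is \<open>1 - \<gamma>\<close> for \<open>\<gamma> \<le> 1\<close>; for \<open>\<gamma> > 1\<close> the
  mass would be \<open>1 / \<gamma>\<close>.\<close>

lemma nn_integral_mp_density:
  assumes "0 < \<gamma>" "\<gamma> \<le> 1"
  shows "(\<integral>\<^sup>+x. ennreal (mp_density \<gamma> x) \<partial>lborel) = 1"
proof -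
  let ?a = "(sqrt \<gamma> - 1)\<^sup>2" and ?b = "(sqrt \<gamma> + 1)\<^sup>2"
  have "sqrt ((0 + 1 - \<gamma>)\<^sup>2 + 4 * \<gamma> * 0) = 1 - \<gamma>" using assms by simp
  then have "((\<lambda>x. 1 / (2 * pi * \<gamma>) * (sqrt ((x - ?a) * (?b - x)) / (x + 0))) has_integral
      1 / (2 * pi * \<gamma>) * (pi * (1 + \<gamma> + 0 - (1 - \<gamma>)))) {?a..?b}"
    using has_integral_mp_weight[OF assms(1), of 0] by (intro has_integral_mult_right) simp
  then have "((\<lambda>x. if x \<in> {?a..?b} then 1 / (2 * pi * \<gamma>) * (sqrt ((x - ?a) * (?b - x)) / (x + 0)) else 0)
      has_integral 1) UNIV"
    unfolding has_integral_restrict_UNIV using assms by simp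
  then have "(mp_density \<gamma> has_integral 1) UNIV"
    by (rule has_integral_eq[rotated]) (simp add: mp_density_def Let_def)
  then show ?thesis
    using nn_integral_has_integral_lborel[OF borel_measurable_mp_density mp_density_nonneg[OF assms(1)]]
    by simp
qed

text \<open>Partial fractions, \<open>1 / (x (x + z)) = (1 / x - 1 / (x + z)) / z\<close>.\<close>

lemma nn_integral_mp_density_resolvent:
  assumes "0 < \<gamma>" "\<gamma> \<le> 1" "0 < z"
  shows "(\<integral>\<^sup>+x. ennreal (mp_density \<gamma> x * (1 / (x + z))) \<partial>lborel) = ennreal (mp_stieltjes \<gamma> z)"
proof -
  let ?a = "(sqrt \<gamma> - 1)\<^sup>2" and ?b = "(sqrt \<gamma> + 1)\<^sup>2"
  let ?R = "\<lambda>x. sqrt ((x - ?a) * (?b - x))"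
  let ?D = "sqrt ((z + 1 - \<gamma>)\<^sup>2 + 4 * \<gamma> * z)"
  have 0: "sqrt ((0 + 1 - \<gamma>)\<^sup>2 + 4 * \<gamma> * 0) = 1 - \<gamma>" using assms by simp
  have "((\<lambda>x. 1 / (2 * pi * \<gamma> * z) * (?R x / (x + 0) - ?R x / (x + z))) has_integral
      1 / (2 * pi * \<gamma> * z) * (pi * (1 + \<gamma> + 0 - (1 - \<gamma>)) - pi * (1 + \<gamma> + z - ?D))) {?a..?b}"
    using has_integral_mp_weight[OF assms(1), of 0] has_integral_mp_weight[OF assms(1), of z] assms
    by (intro has_integral_mult_right has_integral_diff) (simp_all only: 0)
  also have "1 / (2 * pi * \<gamma> * z) * (pi * (1 + \<gamma> + 0 - (1 - \<gamma>)) - pi * (1 + \<gamma> + z - ?D))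
      = mp_stieltjes \<gamma> z"
    using assms by (simp add: mp_stieltjes_def field_simps)
  finally have "((\<lambda>x. if x \<in> {?a..?b} then 1 / (2 * pi * \<gamma> * z) * (?R x / (x + 0) - ?R x / (x + z)) else 0)
      has_integral mp_stieltjes \<gamma> z) UNIV"
    unfolding has_integral_restrict_UNIV .
  moreover have "(if x \<in> {?a..?b} then 1 / (2 * pi * \<gamma> * z) * (?R x / (x + 0) - ?R x / (x + z)) else 0)
      = mp_density \<gamma> x * (1 / (x + z))" for x
  proof (cases "x \<in> {?a..?b} \<and> x \<noteq> 0")
    case True
    then have "0 < x" using order_trans[OF zero_le_power2, of "sqrt \<gamma> - 1" x] by auto
    then have "?R x / (x + 0) - ?R x / (x + z) = z * (?R x / (x * (x + z)))"
      using assms by (simp add: field_simps)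
    then show ?thesis using True assms by (simp add: mp_density_def Let_def mult_ac)
  next
    case False
    moreover have "?R x = 0" if "x \<in> {?a..?b}" "x = 0" using that mp_edges(1)[OF assms(1)] by auto
    ultimately show ?thesis by (auto simp: mp_density_def Let_def)
  qed
  ultimately have "((\<lambda>x. mp_density \<gamma> x * (1 / (x + z))) has_integral mp_stieltjes \<gamma> z) UNIV"
    by simp
  moreover have "0 \<le> mp_density \<gamma> x * (1 / (x + z))" for x
    using mp_density_nonneg[OF assms(1), of x] mp_density_eq_0[OF assms(1), of x] assms(3)
    by (cases "x < 0") auto
  ultimately show ?thesis
    by (intro nn_integral_has_integral_lborel) auto
qed

definition half_line_prob :: "real measure \<Rightarrow> bool" where
  "half_line_prob \<nu> \<longleftrightarrow> prob_space \<nu> \<and> sets \<nu> = sets borel \<and> (AE x in \<nu>. 0 \<le> x)"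

lemma half_line_prob_mp:
  assumes "0 < \<gamma>" "\<gamma> \<le> 1" "0 < c"
  shows "half_line_prob (density lborel (\<lambda>x. ennreal (c * mp_density \<gamma> (c * x))))"
  unfolding half_line_prob_def
proof (intro conjI)
  have "(\<integral>\<^sup>+x. ennreal (c * mp_density \<gamma> (c * x)) \<partial>lborel)
      = ennreal \<bar>c\<bar> * (\<integral>\<^sup>+x. ennreal (mp_density \<gamma> (0 + c * x)) \<partial>lborel)"
    using assms(3) by (subst nn_integral_cmult[symmetric]) (auto simp: ennreal_mult')
  also have "\<dots> = 1"
    using assms by (subst nn_integral_real_affine[symmetric]) (auto simp: nn_integral_mp_density)
  finally show "prob_space (density lborel (\<lambda>x. ennreal (c * mp_density \<gamma> (c * x))))"
    by (intro prob_spaceI) (simp add: emeasure_density)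
  show "AE x in density lborel (\<lambda>x. ennreal (c * mp_density \<gamma> (c * x))). 0 \<le> x"
    using mp_density_eq_0[OF assms(1), of "c * x" for x] assms(3)
    by (subst AE_density) (auto simp: mult_pos_neg intro!: AE_I2 leI)
qed simp

lemma mp_stieltjes_nonneg:
  assumes "0 < \<gamma>" "0 < z"
  shows "0 \<le> mp_stieltjes \<gamma> z"
proof -
  have "z + 1 - \<gamma> \<le> sqrt ((z + 1 - \<gamma>)\<^sup>2 + 4 * \<gamma> * z)"
    using assms by (intro real_le_rsqrt) auto
  then show ?thesis using assms by (simp add: mp_stieltjes_def)
qed

lemma stieltjes_mp:
  assumes "0 < \<gamma>" "\<gamma> \<le> 1" "0 < c" "0 < z"
  shows "(\<integral>x. 1 / (x + z) \<partial>density lborel (\<lambda>x. ennreal (c * mp_density \<gamma> (c * x))))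
         = c * mp_stieltjes \<gamma> (c * z)"
proof -
  let ?\<mu> = "density lborel (\<lambda>x. ennreal (c * mp_density \<gamma> (c * x)))"
  have ge: "AE x in ?\<mu>. 0 \<le> x" using half_line_prob_mp[OF assms(1-3)] by (simp add: half_line_prob_def)
  have S: "0 \<le> mp_stieltjes \<gamma> (c * z)" using assms by (intro mp_stieltjes_nonneg) auto
  have "(\<integral>\<^sup>+x. ennreal (1 / (x + z)) \<partial>?\<mu>)
      = (\<integral>\<^sup>+x. ennreal (c * mp_density \<gamma> (c * x)) * ennreal (1 / (x + z)) \<partial>lborel)"
    by (subst nn_integral_density) auto
  also have "\<dots> = (\<integral>\<^sup>+x. ennreal c * (ennreal \<bar>c\<bar> * ennreal (mp_density \<gamma> (0 + c * x) * (1 / ((0 + c * x) + c * z)))) \<partial>lborel)"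
  proof (rule nn_integral_cong)
    fix x :: real
    have "1 / (x + z) = c * (1 / (c * x + c * z))"
      using assms by (simp add: distrib_left[symmetric])
    then show "ennreal (c * mp_density \<gamma> (c * x)) * ennreal (1 / (x + z)) =
      ennreal c * (ennreal \<bar>c\<bar> * ennreal (mp_density \<gamma> (0 + c * x) * (1 / ((0 + c * x) + c * z))))"
      using assms mp_density_nonneg[OF assms(1)]
      by (simp add: ennreal_mult'[symmetric] mult_ac)
  qed
  also have "\<dots> = ennreal c * (ennreal \<bar>c\<bar> * (\<integral>\<^sup>+x. ennreal (mp_density \<gamma> (0 + c * x) * (1 / ((0 + c * x) + c * z))) \<partial>lborel))"
    by (simp add: nn_integral_cmult)
  also have "\<dots> = ennreal c * ennreal (mp_stieltjes \<gamma> (c * z))"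
    using assms nn_integral_mp_density_resolvent[of \<gamma> "c * z"]
    by (subst nn_integral_real_affine[where c = c and t = 0, symmetric]) auto
  finally have nn: "(\<integral>\<^sup>+x. ennreal (1 / (x + z)) \<partial>?\<mu>) = ennreal (c * mp_stieltjes \<gamma> (c * z))"
    using assms S by (simp add: ennreal_mult')
  show ?thesis
    using assms S ge by (subst integral_eq_nn_integral) (auto simp: nn elim!: eventually_mono)
qed

text \<open>The functional of the limiting loop equation: an empirical Stieltjes transform \<open>S\<close> at \<open>z\<close> turns out to
  satisfy \<open>mp_quadratic \<beta> \<gamma> z S \<approx> 0\<close>.\<close>

definition mp_quadratic :: "real \<Rightarrow> real \<Rightarrow> real \<Rightarrow> real \<Rightarrow> real" where
  "mp_quadratic \<beta> \<gamma> z S = \<beta> / 2 * z * S\<^sup>2 + (\<beta> / (2 * \<gamma>) - \<beta> / 2) * S - (1 - z * S)"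

text \<open>Substituting \<open>z = w \<beta> / (2 \<gamma>)\<close> and \<open>S = 2 \<gamma> / \<beta> m\<close> turns the functional into the quadratic polynomial that
  defines \<open>mp_stieltjes\<close>.\<close>

lemma mp_quadratic_root:
  assumes "0 < \<beta>" "0 < \<gamma>" "0 < z"
  shows "mp_quadratic \<beta> \<gamma> z (2 * \<gamma> / \<beta> * mp_stieltjes \<gamma> (2 * \<gamma> / \<beta> * z)) = 0"
proof -
  define w where "w = 2 * \<gamma> / \<beta> * z"
  define D where "D = sqrt ((w + 1 - \<gamma>)\<^sup>2 + 4 * \<gamma> * w)"
  define m where "m = mp_stieltjes \<gamma> w"
  have w: "0 < w" "z = \<beta> * w / (2 * \<gamma>)" using assms by (simp_all add: w_def)
  have D: "D = 2 * \<gamma> * w * m + (w + 1 - \<gamma>)"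
    using assms w(1) by (simp add: m_def mp_stieltjes_def D_def)
  have "D\<^sup>2 = (w + 1 - \<gamma>)\<^sup>2 + 4 * \<gamma> * w"
    unfolding D_def using assms w(1) by simp
  then have "4 * \<gamma> * w * (\<gamma> * w * m\<^sup>2 + (w + 1 - \<gamma>) * m - 1) = 0"
    unfolding D by (simp add: power2_eq_square algebra_simps)
  then have "\<gamma> * w * m\<^sup>2 + (w + 1 - \<gamma>) * m - 1 = 0" using assms w(1) by simp
  moreover have "mp_quadratic \<beta> \<gamma> z (2 * \<gamma> / \<beta> * m) = \<gamma> * w * m\<^sup>2 + (w + 1 - \<gamma>) * m - 1"
    unfolding mp_quadratic_def w(2) using assms
    by (simp add: power2_eq_square field_simps)
  ultimately show ?thesis by (simp add: m_def w_def)
qed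

text \<open>Stability of the root: on the nonnegative half-line the functional has slope at least \<open>z\<close>. The
  condition \<open>\<gamma> \<le> 1\<close> makes the linear coefficient nonnegative.\<close>

lemma mp_quadratic_inverse_bound:
  assumes "0 < \<beta>" "0 < \<gamma>" "\<gamma> \<le> 1" "0 < z" "0 \<le> S" "0 \<le> T" "mp_quadratic \<beta> \<gamma> z T = 0"
  shows "z * \<bar>S - T\<bar> \<le> \<bar>mp_quadratic \<beta> \<gamma> z S\<bar>"
proof -
  define A where "A = \<beta> / (2 * \<gamma>) - \<beta> / 2"
  let ?g = "\<beta> / 2 * z * (S + T) + A"
  have "\<beta> / 2 \<le> \<beta> / (2 * \<gamma>)" using assms by (simp add: field_simps)
  then have "0 \<le> ?g" using assms unfolding A_def by (intro add_nonneg_nonneg mult_nonneg_nonneg) auto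
  then have "z * \<bar>S - T\<bar> \<le> (?g + z) * \<bar>S - T\<bar>" by (intro mult_right_mono) auto
  also have "\<dots> = \<bar>(?g + z) * (S - T)\<bar>" using \<open>0 \<le> ?g\<close> assms by (simp add: abs_mult)
  also have "(?g + z) * (S - T) = mp_quadratic \<beta> \<gamma> z S - mp_quadratic \<beta> \<gamma> z T"
    unfolding mp_quadratic_def A_def[symmetric] by (simp add: power2_eq_square field_simps)
  finally show ?thesis using assms(7) by simp
qed

section \<open>Expansion of the likelihood ratio\<close>

lemma pairs_Suc: "pairs (Suc n) = pairs n \<union> (\<lambda>i. (i, Suc n)) ` {1..n}"
  by (auto simp: pairs_def)

lemma sum_square_eq_pairs:
  fixes g :: "nat \<Rightarrow> nat \<Rightarrow> real"
  assumes "\<And>i j. g i j = g j i"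
  shows "(\<Sum>i=1..n. \<Sum>j=1..n. g i j) = 2 * (\<Sum>(i, j)\<in>pairs n. g i j) + (\<Sum>i=1..n. g i i)"
proof (induction n)
  case 0
  have "pairs 0 = {}" by (auto simp: pairs_def)
  then show ?case by simp
next
  case (Suc n)
  have "(\<Sum>(i, j)\<in>pairs (Suc n). g i j) = (\<Sum>(i, j)\<in>pairs n. g i j) + (\<Sum>i=1..n. g i (Suc n))"
    unfolding pairs_Suc
    by (subst sum.union_disjoint) (auto simp: sum.reindex inj_on_def, auto simp: pairs_def)
  moreover have "(\<Sum>j=1..n. g (Suc n) j) = (\<Sum>i=1..n. g i (Suc n))"
    by (rule sum.cong) (auto intro: assms)
  ultimately show ?case using Suc.IH by (simp add: sum.distrib)
qed

lemma card_pairs_le: "real (card (pairs n)) \<le> (real n)\<^sup>2"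
proof -
  have "card (pairs n) \<le> card ({1..n} \<times> {1..n})"
    by (rule card_mono) (auto simp: pairs_def)
  then have "card (pairs n) \<le> n * n" by simp
  then show ?thesis by (metis of_nat_le_iff of_nat_mult power2_eq_square)
qed

lemma abs_add_le:
  fixes a b :: real
  shows "\<bar>a\<bar> \<le> A \<Longrightarrow> \<bar>b\<bar> \<le> B \<Longrightarrow> \<bar>a + b\<bar> \<le> A + B"
  by (rule order_trans[OF abs_triangle_ineq add_mono])

lemma ln_scaled_bound:
  fixes e c K t :: real
  assumes "\<bar>t * c\<bar> \<le> 1 / 2" "\<bar>c\<bar> \<le> K"
  shows "\<bar>e * ln (1 + t * c) - e * (t * c)\<bar> \<le> 2 * t\<^sup>2 * (\<bar>e\<bar> * K\<^sup>2)"
proof -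
  have "\<bar>e * ln (1 + t * c) - e * (t * c)\<bar> = \<bar>e\<bar> * \<bar>ln (1 + t * c) - t * c\<bar>"
    by (simp only: right_diff_distrib[symmetric] abs_mult)
  also have "\<dots> \<le> \<bar>e\<bar> * (2 * (t * c)\<^sup>2)"
    by (intro mult_left_mono abs_ln_one_plus_x_minus_x_bound assms) simp
  also have "\<dots> \<le> \<bar>e\<bar> * (2 * (t\<^sup>2 * K\<^sup>2))"
    unfolding power_mult_distrib using assms(2) by (intro mult_left_mono abs_le_square_iff[THEN iffD1]) auto
  finally show ?thesis by (simp only: mult_ac)
qed

text \<open>The derivative of \<open>log_ratio\<close> in \<open>t\<close> at 0.\<close>

definition linear_part :: "nat \<Rightarrow> real \<Rightarrow> real \<Rightarrow> real \<Rightarrow> real \<Rightarrow> (nat \<Rightarrow> real) \<Rightarrow> real" where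
  "linear_part n \<beta> b1 b2 \<zeta> l =
     \<beta> * (\<Sum>(i, j)\<in>pairs n. field_slope \<zeta> (l i) (l j))
     + (\<Sum>i=1..n. b1 * ((1 - l i) / (l i + \<zeta>)) - b2 * (l i / (l i + \<zeta>)) + field_slope \<zeta> (l i) (l i))"

lemma log_ratio_linear_part:
  assumes "0 < \<beta>" "0 < \<zeta>" "\<bar>t\<bar> * (1 + 1 / \<zeta>) \<le> 1 / 2" "\<forall>i\<in>{1..n}. l i \<in> {0..1}"
  shows "\<bar>log_ratio n \<beta> b1 b2 \<zeta> t l - t * linear_part n \<beta> b1 b2 \<zeta> l\<bar>
     \<le> 2 * t\<^sup>2 * (\<beta> * (real n)\<^sup>2 * (1 + 1 / \<zeta>)\<^sup>2
          + real n * (\<bar>b1\<bar> * (1 / \<zeta>)\<^sup>2 + \<bar>b2\<bar> * 1\<^sup>2 + 1 * (1 + 1 / \<zeta>)\<^sup>2))"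
proof -
  let ?D = "1 + 1 / \<zeta>"
  have l: "l i \<in> {0..1}" if "i \<in> {1..n}" for i using assms(4) that by blast
  note s = deform_slopes[OF assms(2,3)]
  let ?A = "\<lambda>(i, j). \<beta> * ln (1 + t * field_slope \<zeta> (l i) (l j)) - \<beta> * (t * field_slope \<zeta> (l i) (l j))"
  let ?B1 = "\<lambda>i. b1 * ln (1 + t * ((1 - l i) / (l i + \<zeta>))) - b1 * (t * ((1 - l i) / (l i + \<zeta>)))"
  let ?B2 = "\<lambda>i. b2 * ln (1 + t * - (l i / (l i + \<zeta>))) - b2 * (t * - (l i / (l i + \<zeta>)))"
  let ?B3 = "\<lambda>i. 1 * ln (1 + t * field_slope \<zeta> (l i) (l i)) - 1 * (t * field_slope \<zeta> (l i) (l i))"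
  have A: "\<bar>?A e\<bar> \<le> 2 * t\<^sup>2 * (\<beta> * ?D\<^sup>2)" if "e \<in> pairs n" for e
  proof -
    obtain i j where e: "e = (i, j)" by force
    have ij: "i \<in> {1..n}" "j \<in> {1..n}" using that by (auto simp: e pairs_def)
    show ?thesis
      using ln_scaled_bound[OF s(1)[OF l[OF ij(1)] l[OF ij(2)]] field_slope_bound[OF assms(2)], of \<beta>] l[OF ij(1)] l[OF ij(2)] assms(1)
      by (simp add: e)
  qed
  have B: "\<bar>?B1 i + ?B2 i + ?B3 i\<bar> \<le> 2 * t\<^sup>2 * (\<bar>b1\<bar> * (1 / \<zeta>)\<^sup>2 + \<bar>b2\<bar> * 1\<^sup>2 + 1 * ?D\<^sup>2)" if i: "i \<in> {1..n}" for i
  proof -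
    have li: "0 \<le> l i" "l i \<le> 1" using l[OF i] by auto
    note b = s[OF l[OF i] l[OF i]]
    have "(1 - l i) / (l i + \<zeta>) \<le> 1 / \<zeta>" using li assms(2) by (intro frac_le) auto
    then have u: "\<bar>(1 - l i) / (l i + \<zeta>)\<bar> \<le> 1 / \<zeta>" using li assms(2) by simp
    have w: "\<bar>- (l i / (l i + \<zeta>))\<bar> \<le> 1" using li assms(2) by simp
    note d = field_slope_bound[OF assms(2) li(1) li(1)]
    have "\<bar>?B1 i\<bar> \<le> 2 * t\<^sup>2 * (\<bar>b1\<bar> * (1 / \<zeta>)\<^sup>2)" by (rule ln_scaled_bound[OF b(2) u])
    moreover have "\<bar>?B2 i\<bar> \<le> 2 * t\<^sup>2 * (\<bar>b2\<bar> * 1\<^sup>2)" by (rule ln_scaled_bound[OF b(3) w])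
    moreover have "\<bar>?B3 i\<bar> \<le> 2 * t\<^sup>2 * (\<bar>1\<bar> * ?D\<^sup>2)" by (rule ln_scaled_bound[OF b(1) d])
    ultimately have "\<bar>?B1 i + ?B2 i + ?B3 i\<bar> \<le> 2 * t\<^sup>2 * (\<bar>b1\<bar> * (1 / \<zeta>)\<^sup>2)
       + 2 * t\<^sup>2 * (\<bar>b2\<bar> * 1\<^sup>2) + 2 * t\<^sup>2 * (\<bar>1\<bar> * ?D\<^sup>2)" by (intro abs_add_le)
    then show ?thesis by (simp only: distrib_left abs_one)
  qed
  have eq: "log_ratio n \<beta> b1 b2 \<zeta> t l - t * linear_part n \<beta> b1 b2 \<zeta> l
      = (\<Sum>e\<in>pairs n. ?A e) + (\<Sum>i=1..n. ?B1 i + ?B2 i + ?B3 i)"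
  proof -
    have 1: "(\<Sum>e\<in>pairs n. ?A e) = (\<Sum>(i, j)\<in>pairs n. \<beta> * ln (1 + t * field_slope \<zeta> (l i) (l j)))
        - t * (\<beta> * (\<Sum>(i, j)\<in>pairs n. field_slope \<zeta> (l i) (l j)))"
      unfolding sum_distrib_left sum_subtractf[symmetric]
      by (rule sum.cong) (auto simp: algebra_simps)
    have 2: "(\<Sum>i=1..n. ?B1 i + ?B2 i + ?B3 i) = (\<Sum>i=1..n. b1 * ln (1 + t * ((1 - l i) / (l i + \<zeta>)))
          + b2 * ln (1 + t * - (l i / (l i + \<zeta>))) + ln (1 + t * field_slope \<zeta> (l i) (l i)))
        - t * (\<Sum>i=1..n. b1 * ((1 - l i) / (l i + \<zeta>)) - b2 * (l i / (l i + \<zeta>)) + field_slope \<zeta> (l i) (l i))"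
      unfolding sum_distrib_left sum_subtractf[symmetric]
      by (rule sum.cong) (simp_all add: algebra_simps)
    show ?thesis unfolding log_ratio_def linear_part_def 1 2 by (simp only: distrib_left)
  qed
  have "\<bar>(\<Sum>e\<in>pairs n. ?A e) + (\<Sum>i=1..n. ?B1 i + ?B2 i + ?B3 i)\<bar>
      \<le> (\<Sum>e\<in>pairs n. \<bar>?A e\<bar>) + (\<Sum>i=1..n. \<bar>?B1 i + ?B2 i + ?B3 i\<bar>)"
    by (rule order_trans[OF abs_triangle_ineq add_mono[OF sum_abs sum_abs]])
  also have "\<dots> \<le> real (card (pairs n)) * (2 * t\<^sup>2 * (\<beta> * ?D\<^sup>2))
      + real (card {1..n}) * (2 * t\<^sup>2 * (\<bar>b1\<bar> * (1 / \<zeta>)\<^sup>2 + \<bar>b2\<bar> * 1\<^sup>2 + 1 * ?D\<^sup>2))"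
    by (intro add_mono sum_bounded_above A B)
  also have "\<dots> \<le> (real n)\<^sup>2 * (2 * t\<^sup>2 * (\<beta> * ?D\<^sup>2))
      + real n * (2 * t\<^sup>2 * (\<bar>b1\<bar> * (1 / \<zeta>)\<^sup>2 + \<bar>b2\<bar> * 1\<^sup>2 + 1 * ?D\<^sup>2))"
    using card_pairs_le[of n] assms(1) by (intro add_mono mult_right_mono) auto
  finally show ?thesis unfolding eq by (simp only: distrib_left mult_ac)
qed

definition emp_stieltjes :: "nat \<Rightarrow> real \<Rightarrow> (nat \<Rightarrow> real) \<Rightarrow> real" where
  "emp_stieltjes n z x = (\<Sum>i=1..n. 1 / (x i + z)) / real n"

lemma emp_stieltjes_bounds:
  assumes "0 < n" "0 < z" "\<forall>i\<in>{1..n}. 0 \<le> x i"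
  shows "0 \<le> emp_stieltjes n z x" "z * emp_stieltjes n z x \<le> 1"
proof -
  show "0 \<le> emp_stieltjes n z x"
    unfolding emp_stieltjes_def using assms by (intro divide_nonneg_nonneg sum_nonneg) auto
  have "(\<Sum>i=1..n. 1 / (x i + z)) \<le> real (card {1..n}) * (1 / z)"
    using assms by (intro sum_bounded_above frac_le) auto
  then show "z * emp_stieltjes n z x \<le> 1"
    using assms by (simp add: emp_stieltjes_def field_simps)
qed

text \<open>All sums are expressed by \<open>T = \<Sum>\<^sub>i 1 / (l\<^sub>i + \<zeta>)\<close>. The double sum of divided differences contributes
  \<open>T\<^sup>2\<close>, hence the quadratic term of \<open>mp_quadratic\<close>; everything that vanishes when
  \<open>s \<rightarrow> 0\<close>, \<open>n \<rightarrow> \<infinity>\<close> and \<open>b1 / n \<rightarrow> \<beta> / (2 * \<gamma>) - \<beta> / 2\<close> is collected in the second summand.\<close>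

lemma linear_part_eq:
  fixes \<beta> \<gamma> :: real
  assumes "0 < n" "0 < s" "0 < z" "\<forall>i\<in>{1..n}. l i \<in> {0..1}"
  defines "S \<equiv> emp_stieltjes n z (\<lambda>i. l i / s)" and "p \<equiv> jacobi_p n \<beta>"
  defines "Q \<equiv> (\<Sum>i=1..n. field_slope (s * z) (l i) (l i))"
  shows "s * linear_part n \<beta> b1 (real n / s - p) (s * z) l =
     (real n)\<^sup>2 * (mp_quadratic \<beta> \<gamma> z S + (\<beta> / 2 * s * ((z * S)\<^sup>2 - 1) + (1 - \<beta> / 2) * s * Q / (real n)\<^sup>2
       + b1 / real n * s * (z * S - 1) + (b1 / real n - (\<beta> / (2 * \<gamma>) - \<beta> / 2)) * S
       + p * s / real n * (1 - z * S)))"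
proof -
  define N where "N = real n"
  define \<zeta> where "\<zeta> = s * z"
  define T where "T = (\<Sum>i=1..n. 1 / (l i + \<zeta>))"
  have N: "0 < N" using assms by (simp add: N_def)
  have \<zeta>: "0 < \<zeta>" using assms by (simp add: \<zeta>_def)
  have l: "0 < l i + \<zeta>" if "i \<in> {1..n}" for i using assms(4) that \<zeta> by force
  have sT: "s * T = N * S"
  proof -
    have "1 / (l i / s + z) = s * (1 / (l i + \<zeta>))" for i
      using assms(2) by (simp add: \<zeta>_def divide_simps mult.commute)
    then have "(\<Sum>i=1..n. 1 / (l i / s + z)) = s * T" by (simp only: T_def sum_distrib_left)
    then show ?thesis using N by (simp add: S_def emp_stieltjes_def N_def)
  qed
  \<comment> \<open>The full double sum is \<open>\<zeta> (1 + \<zeta>) T\<^sup>2 - n\<^sup>2\<close>; the sum over pairs is half of it without the diagonal.\<close>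
  define r where "r i = 1 / (l i + \<zeta>)" for i
  have "(\<Sum>i=1..n. \<Sum>j=1..n. field_slope \<zeta> (l i) (l j)) = (\<Sum>i=1..n. \<Sum>j=1..n. \<zeta> * (1 + \<zeta>) * (r i * r j) - 1)"
    by (simp add: field_slope_def r_def)
  also have "\<dots> = \<zeta> * (1 + \<zeta>) * (\<Sum>i=1..n. \<Sum>j=1..n. r i * r j) - N * N"
    by (simp add: sum_subtractf N_def sum_distrib_left)
  also have "(\<Sum>i=1..n. \<Sum>j=1..n. r i * r j) = T * T"
    by (simp only: T_def r_def sum_product)
  finally have dd: "2 * (\<Sum>(i, j)\<in>pairs n. field_slope \<zeta> (l i) (l j)) = \<zeta> * (1 + \<zeta>) * (T * T) - N * N - Q"
    using sum_square_eq_pairs[of "\<lambda>i j. field_slope \<zeta> (l i) (l j)" n] by (simp add: field_slope_def mult.commute Q_def \<zeta>_def)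
  have "(\<Sum>i=1..n. (1 - l i) / (l i + \<zeta>)) = (\<Sum>i=1..n. (1 + \<zeta>) * (1 / (l i + \<zeta>)) - 1)"
  proof (rule sum.cong[OF refl])
    fix i assume "i \<in> {1..n}"
    from l[OF this] show "(1 - l i) / (l i + \<zeta>) = (1 + \<zeta>) * (1 / (l i + \<zeta>)) - 1" by (simp add: divide_simps)
  qed
  then have u: "(\<Sum>i=1..n. (1 - l i) / (l i + \<zeta>)) = (1 + \<zeta>) * T - N"
    by (simp add: sum_subtractf T_def sum_distrib_left N_def)
  have "(\<Sum>i=1..n. l i / (l i + \<zeta>)) = (\<Sum>i=1..n. 1 - \<zeta> * (1 / (l i + \<zeta>)))"
  proof (rule sum.cong[OF refl])
    fix i assume "i \<in> {1..n}"
    from l[OF this] show "l i / (l i + \<zeta>) = 1 - \<zeta> * (1 / (l i + \<zeta>))" by (simp add: divide_simps)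
  qed
  then have w: "(\<Sum>i=1..n. l i / (l i + \<zeta>)) = N - \<zeta> * T"
    by (simp add: sum_subtractf T_def sum_distrib_left N_def)
  define B where "B = N / s - p"
  have B: "s * B = N - p * s" using assms(2) by (simp add: B_def algebra_simps)
  have "linear_part n \<beta> b1 B \<zeta> l =
      \<beta> / 2 * (2 * (\<Sum>(i, j)\<in>pairs n. field_slope \<zeta> (l i) (l j)))
      + (b1 * (\<Sum>i=1..n. (1 - l i) / (l i + \<zeta>)) - B * (\<Sum>i=1..n. l i / (l i + \<zeta>)) + Q)"
    unfolding linear_part_def Q_def \<zeta>_def by (simp add: sum.distrib sum_subtractf sum_distrib_left)
  also have "\<dots> = \<beta> / 2 * (\<zeta> * (1 + \<zeta>) * (T * T) - N * N - Q)
      + (b1 * ((1 + \<zeta>) * T - N) - B * (N - \<zeta> * T) + Q)"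
    unfolding dd u w ..
  finally have "s * linear_part n \<beta> b1 B \<zeta> l = s * (\<beta> / 2 * (\<zeta> * (1 + \<zeta>) * (T * T) - N * N - Q)
      + (b1 * ((1 + \<zeta>) * T - N) - B * (N - \<zeta> * T) + Q))"
    by (simp only:)
  also have "\<dots> = \<beta> / 2 * (s * (\<zeta> * (1 + \<zeta>) * (T * T)) - s * (N * N) - s * Q)
      + (b1 * (s * ((1 + \<zeta>) * T - N)) - (s * B) * (N - \<zeta> * T) + s * Q)"
    by (simp add: algebra_simps)
  also have "s * (\<zeta> * (1 + \<zeta>) * (T * T)) = z * (1 + s * z) * ((s * T) * (s * T))"
    by (simp add: \<zeta>_def algebra_simps)
  also have "s * ((1 + \<zeta>) * T - N) = (1 + s * z) * (s * T) - s * N"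
    by (simp add: \<zeta>_def algebra_simps)
  also have "\<zeta> * T = z * (s * T)" by (simp add: \<zeta>_def)
  finally have L: "s * linear_part n \<beta> b1 B \<zeta> l =
      \<beta> / 2 * (z * (1 + s * z) * ((N * S) * (N * S)) - s * (N * N) - s * Q)
      + (b1 * ((1 + s * z) * (N * S) - s * N) - (N - p * s) * (N - z * (N * S)) + s * Q)"
    unfolding sT B .
  define A where "A = \<beta> / (2 * \<gamma>) - \<beta> / 2"
  define X Y W where "X = s * Q / N\<^sup>2" and "Y = b1 / N" and "W = p * s / N"
  have XYW: "s * Q = N * N * X" "b1 = N * Y" "p * s = N * W"
    using N by (simp_all add: X_def Y_def W_def power2_eq_square)
  have "s * linear_part n \<beta> b1 B \<zeta> l = N\<^sup>2 * (\<beta> / 2 * z * S\<^sup>2 + A * S - (1 - z * S)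
      + (\<beta> / 2 * s * ((z * S)\<^sup>2 - 1) + (1 - \<beta> / 2) * X + Y * s * (z * S - 1) + (Y - A) * S + W * (1 - z * S)))"
    unfolding L XYW(1,3) unfolding XYW(2) by (simp add: power2_eq_square algebra_simps)
  also have "(1 - \<beta> / 2) * X = (1 - \<beta> / 2) * s * Q / N\<^sup>2" by (simp add: X_def)
  finally show ?thesis
    by (simp only: mp_quadratic_def N_def \<zeta>_def A_def Y_def W_def B_def)
qed

text \<open>Bounds, per unit of \<open>\<tau> n\<^sup>2\<close> and of \<open>\<tau>\<^sup>2 n\<^sup>2\<close> respectively, for the deviation of \<open>log_ratio\<close> from
  \<open>\<tau> n\<^sup>2 mp_quadratic\<close>: the first collects the lower order terms of the linear part, the second the
  quadratic remainder of the logarithms. The first tends to 0 and the second stays bounded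
  (\<open>err_limits\<close> below).\<close>

definition lin_err :: "nat \<Rightarrow> real \<Rightarrow> real \<Rightarrow> real \<Rightarrow> real \<Rightarrow> real \<Rightarrow> real" where
  "lin_err n \<beta> \<gamma> z s b1 = \<beta> / 2 * s + \<bar>1 - \<beta> / 2\<bar> * (s + 1 / z) / real n + \<bar>b1\<bar> / real n * s
     + \<bar>b1 / real n - (\<beta> / (2 * \<gamma>) - \<beta> / 2)\<bar> / z + jacobi_p n \<beta> * s / real n"

definition quad_err :: "nat \<Rightarrow> real \<Rightarrow> real \<Rightarrow> real \<Rightarrow> real \<Rightarrow> real" where
  "quad_err n \<beta> z s b1 = 2 * (\<beta> * (s + 1 / z)\<^sup>2
     + (\<bar>b1\<bar> * (1 / z)\<^sup>2 + \<bar>real n / s - jacobi_p n \<beta>\<bar> * s\<^sup>2 + (s + 1 / z)\<^sup>2) / real n)"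

lemma log_ratio_expansion:
  assumes "0 < n" "0 < \<beta>" "0 < s" "0 < z" "\<bar>\<tau>\<bar> * (s + 1 / z) \<le> 1 / 2" "\<forall>i\<in>{1..n}. l i \<in> {0..1}"
  shows "\<bar>log_ratio n \<beta> b1 (real n / s - jacobi_p n \<beta>) (s * z) (\<tau> * s) l
           - \<tau> * (real n)\<^sup>2 * mp_quadratic \<beta> \<gamma> z (emp_stieltjes n z (\<lambda>i. l i / s))\<bar>
     \<le> (real n)\<^sup>2 * (\<bar>\<tau>\<bar> * lin_err n \<beta> \<gamma> z s b1 + \<tau>\<^sup>2 * quad_err n \<beta> z s b1)"
proof -
  let ?\<zeta> = "s * z" and ?t = "\<tau> * s" and ?p = "jacobi_p n \<beta>" and ?b2 = "real n / s - jacobi_p n \<beta>"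
  define S where "S = emp_stieltjes n z (\<lambda>i. l i / s)"
  define Q where "Q = (\<Sum>i=1..n. field_slope (s * z) (l i) (l i))"
  define E where "E = \<beta> / 2 * s * ((z * S)\<^sup>2 - 1) + (1 - \<beta> / 2) * s * Q / (real n)\<^sup>2
       + b1 / real n * s * (z * S - 1) + (b1 / real n - (\<beta> / (2 * \<gamma>) - \<beta> / 2)) * S
       + ?p * s / real n * (1 - z * S)"
  have \<zeta>: "0 < ?\<zeta>" using assms by simp
  have sD: "s * (1 + 1 / ?\<zeta>) = s + 1 / z" "s * (1 / ?\<zeta>) = 1 / z"
    using assms by (simp_all add: field_simps)
  have t: "\<bar>?t\<bar> * (1 + 1 / ?\<zeta>) \<le> 1 / 2"
    using assms(3,5) sD(1) by (simp only: abs_mult mult.assoc abs_of_pos)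
  have l: "l i \<in> {0..1}" if "i \<in> {1..n}" for i using assms(6) that by blast
  have S: "0 \<le> S" "z * S \<le> 1" "0 \<le> z * S"
    using emp_stieltjes_bounds[OF assms(1,4), of "\<lambda>i. l i / s"] l assms by (auto simp: S_def)
  have p: "0 \<le> ?p" using assms by simp
  have Q: "\<bar>Q\<bar> \<le> real n * (1 + 1 / ?\<zeta>)"
  proof -
    have "\<bar>Q\<bar> \<le> (\<Sum>i=1..n. \<bar>field_slope (s * z) (l i) (l i)\<bar>)" unfolding Q_def by (rule sum_abs)
    also have "\<dots> \<le> real (card {1..n}) * (1 + 1 / ?\<zeta>)"
      using l \<zeta> by (intro sum_bounded_above field_slope_bound) auto
    finally show ?thesis by simp
  qed
  have lin: "?t * linear_part n \<beta> b1 ?b2 ?\<zeta> l = \<tau> * (real n)\<^sup>2 * mp_quadratic \<beta> \<gamma> z S + \<tau> * (real n)\<^sup>2 * E"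
    using linear_part_eq[OF assms(1,3,4,6), of \<beta> b1 \<gamma>]
    unfolding S_def[symmetric] Q_def[symmetric] E_def[symmetric] by (simp add: algebra_simps)
  have "\<bar>\<beta> / 2 * s * ((z * S)\<^sup>2 - 1)\<bar> \<le> \<beta> / 2 * s * 1"
    unfolding abs_mult using assms S by (intro mult_mono) (auto simp: abs_le_iff power_le_one)
  moreover have "\<bar>(1 - \<beta> / 2) * s * Q / (real n)\<^sup>2\<bar> \<le> \<bar>1 - \<beta> / 2\<bar> * (s + 1 / z) / real n"
  proof -
    have "\<bar>(1 - \<beta> / 2) * s * Q / (real n)\<^sup>2\<bar> = \<bar>1 - \<beta> / 2\<bar> * s * \<bar>Q\<bar> / (real n)\<^sup>2"
      using assms by (simp add: abs_mult)
    also have "\<dots> \<le> \<bar>1 - \<beta> / 2\<bar> * s * (real n * (1 + 1 / ?\<zeta>)) / (real n)\<^sup>2"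
      using assms by (intro divide_right_mono mult_left_mono Q) auto
    also have "\<dots> = \<bar>1 - \<beta> / 2\<bar> * (s * (1 + 1 / ?\<zeta>)) / real n"
      using assms(1) by (simp add: power2_eq_square)
    finally show ?thesis unfolding sD .
  qed
  moreover have "\<bar>b1 / real n * s * (z * S - 1)\<bar> \<le> \<bar>b1\<bar> / real n * s * 1"
  proof -
    have "\<bar>b1 / real n * s * (z * S - 1)\<bar> = \<bar>b1\<bar> / real n * s * \<bar>z * S - 1\<bar>"
      using assms by (simp add: abs_mult)
    also have "\<dots> \<le> \<bar>b1\<bar> / real n * s * 1" using assms S by (intro mult_left_mono) auto
    finally show ?thesis .
  qed
  moreover have "\<bar>(b1 / real n - (\<beta> / (2 * \<gamma>) - \<beta> / 2)) * S\<bar> \<le> \<bar>b1 / real n - (\<beta> / (2 * \<gamma>) - \<beta> / 2)\<bar> / z"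
  proof -
    have "S \<le> 1 / z" using S assms by (simp add: field_simps)
    then have "\<bar>b1 / real n - (\<beta> / (2 * \<gamma>) - \<beta> / 2)\<bar> * S \<le> \<bar>b1 / real n - (\<beta> / (2 * \<gamma>) - \<beta> / 2)\<bar> * (1 / z)"
      by (rule mult_left_mono) simp
    then show ?thesis using S by (simp add: abs_mult)
  qed
  moreover have "\<bar>?p * s / real n * (1 - z * S)\<bar> \<le> ?p * s / real n"
  proof -
    have "?p * s / real n * (1 - z * S) \<le> ?p * s / real n * 1"
      using assms p S by (intro mult_left_mono) auto
    moreover have "0 \<le> ?p * s / real n * (1 - z * S)"
      using assms p S by (intro mult_nonneg_nonneg divide_nonneg_nonneg) auto
    ultimately show ?thesis by simp
  qed
  ultimately have E: "\<bar>E\<bar> \<le> lin_err n \<beta> \<gamma> z s b1"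
    unfolding E_def lin_err_def mult_1_right by (intro abs_add_le)
  have quad: "2 * ?t\<^sup>2 * (\<beta> * (real n)\<^sup>2 * (1 + 1 / ?\<zeta>)\<^sup>2
          + real n * (\<bar>b1\<bar> * (1 / ?\<zeta>)\<^sup>2 + \<bar>?b2\<bar> * 1\<^sup>2 + 1 * (1 + 1 / ?\<zeta>)\<^sup>2))
      = (real n)\<^sup>2 * (\<tau>\<^sup>2 * quad_err n \<beta> z s b1)"
  proof -
    have "2 * ?t\<^sup>2 * (\<beta> * (real n)\<^sup>2 * (1 + 1 / ?\<zeta>)\<^sup>2
          + real n * (\<bar>b1\<bar> * (1 / ?\<zeta>)\<^sup>2 + \<bar>?b2\<bar> * 1\<^sup>2 + 1 * (1 + 1 / ?\<zeta>)\<^sup>2))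
       = 2 * \<tau>\<^sup>2 * (\<beta> * (real n)\<^sup>2 * (s * (1 + 1 / ?\<zeta>))\<^sup>2
          + real n * (\<bar>b1\<bar> * (s * (1 / ?\<zeta>))\<^sup>2 + \<bar>?b2\<bar> * s\<^sup>2 + (s * (1 + 1 / ?\<zeta>))\<^sup>2))"
      unfolding power_mult_distrib by (simp only: distrib_left power_one mult_1_left mult_1_right mult_ac)
    also have "\<dots> = 2 * \<tau>\<^sup>2 * (\<beta> * (real n)\<^sup>2 * (s + 1 / z)\<^sup>2
          + real n * (\<bar>b1\<bar> * (1 / z)\<^sup>2 + \<bar>?b2\<bar> * s\<^sup>2 + (s + 1 / z)\<^sup>2))"
      unfolding sD ..
    also have "real n * (\<bar>b1\<bar> * (1 / z)\<^sup>2 + \<bar>?b2\<bar> * s\<^sup>2 + (s + 1 / z)\<^sup>2)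
        = (real n)\<^sup>2 * ((\<bar>b1\<bar> * (1 / z)\<^sup>2 + \<bar>?b2\<bar> * s\<^sup>2 + (s + 1 / z)\<^sup>2) / real n)"
      using assms(1) by (simp add: power2_eq_square)
    finally show ?thesis unfolding quad_err_def by (simp only: distrib_left mult_ac)
  qed
  have "\<bar>log_ratio n \<beta> b1 ?b2 ?\<zeta> ?t l - \<tau> * (real n)\<^sup>2 * mp_quadratic \<beta> \<gamma> z S\<bar>
      \<le> \<bar>\<tau> * (real n)\<^sup>2 * E\<bar> + (real n)\<^sup>2 * (\<tau>\<^sup>2 * quad_err n \<beta> z s b1)"
  proof -
    have split: "\<bar>x - y\<bar> \<le> \<bar>e\<bar> + q" if "\<bar>x - (y + e)\<bar> \<le> q" for x y e q :: real
      using that by linarith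
    show ?thesis
      by (rule split) (use log_ratio_linear_part[OF assms(2) \<zeta> t assms(6), of b1 ?b2] in \<open>simp only: lin quad\<close>)
  qed
  also have "\<bar>\<tau> * (real n)\<^sup>2 * E\<bar> \<le> \<bar>\<tau>\<bar> * (real n)\<^sup>2 * lin_err n \<beta> \<gamma> z s b1"
    unfolding abs_mult using E by (intro mult_mono) auto
  finally show ?thesis unfolding S_def by (simp add: algebra_simps)
qed

section \<open>Weak convergence on the half-line from Stieltjes transforms\<close>

lemma integrable_half_line:
  fixes h :: "real \<Rightarrow> real"
  assumes "half_line_prob N" "h \<in> borel_measurable borel" "\<And>x. 0 \<le> x \<Longrightarrow> \<bar>h x\<bar> \<le> B"
  shows "integrable N h"
proof -
  interpret prob_space N using assms(1) by (simp add: half_line_prob_def)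
  show ?thesis
  proof (rule integrable_const_bound)
    have "AE x in N. 0 \<le> x" using assms(1) by (simp add: half_line_prob_def)
    then show "AE x in N. norm (h x) \<le> B" by eventually_elim (simp add: assms(3))
    show "h \<in> borel_measurable N"
      using assms(1,2) by (simp add: half_line_prob_def cong: measurable_cong_sets)
  qed
qed

lemma integral_half_line_diff_le:
  fixes g h :: "real \<Rightarrow> real"
  assumes "half_line_prob N" "g \<in> borel_measurable borel" "h \<in> borel_measurable borel" "e \<in> borel_measurable borel"
    and "\<And>x. 0 \<le> x \<Longrightarrow> \<bar>g x\<bar> \<le> B" "\<And>x. 0 \<le> x \<Longrightarrow> \<bar>h x\<bar> \<le> C" "\<And>x. 0 \<le> x \<Longrightarrow> \<bar>e x\<bar> \<le> E"
    and "\<And>x. 0 \<le> x \<Longrightarrow> \<bar>g x - h x\<bar> \<le> e x"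
  shows "\<bar>(\<integral>x. g x \<partial>N) - (\<integral>x. h x \<partial>N)\<bar> \<le> (\<integral>x. e x \<partial>N)"
proof -
  have i: "integrable N g" "integrable N h" "integrable N e"
    using integrable_half_line[OF assms(1)] assms by metis+
  have "\<bar>(\<integral>x. g x \<partial>N) - (\<integral>x. h x \<partial>N)\<bar> = \<bar>\<integral>x. g x - h x \<partial>N\<bar>" using i by simp
  also have "\<dots> \<le> (\<integral>x. \<bar>g x - h x\<bar> \<partial>N)" by (rule integral_abs_bound)
  also have "\<dots> \<le> (\<integral>x. e x \<partial>N)"
  proof (rule integral_mono_AE)
    have "AE x in N. 0 \<le> x" using assms(1) by (simp add: half_line_prob_def)
    then show "AE x in N. \<bar>g x - h x\<bar> \<le> e x" by eventually_elim (rule assms(8))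
  qed (use i in auto)
  finally show ?thesis .
qed

lemma integral_const_half_line: "half_line_prob N \<Longrightarrow> (\<integral>x. c \<partial>N) = (c::real)"
  using prob_space.prob_space by (force simp: half_line_prob_def)

text \<open>The secant of \<open>x ^ Suc k\<close> lies between its tangent slopes at the two end points.\<close>

lemma power_diff_bounds:
  fixes a b :: real
  assumes "0 \<le> b" "b \<le> a"
  shows "real (Suc k) * b ^ k * (a - b) \<le> a ^ Suc k - b ^ Suc k"
    and "a ^ Suc k - b ^ Suc k \<le> real (Suc k) * a ^ k * (a - b)"
proof (induction k)
  case (Suc k)
  have eq: "a ^ Suc (Suc k) - b ^ Suc (Suc k) = b * (a ^ Suc k - b ^ Suc k) + a ^ Suc k * (a - b)"
    "a ^ Suc (Suc k) - b ^ Suc (Suc k) = a * (a ^ Suc k - b ^ Suc k) + b ^ Suc k * (a - b)"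
    by (simp_all add: algebra_simps)
  have le: "b ^ Suc k * (a - b) \<le> a ^ Suc k * (a - b)"
    using assms by (intro mult_right_mono power_mono) auto
  {
    case 1
    show ?case using mult_left_mono[OF Suc.IH(1) assms(1)] le unfolding eq(1)
      by (simp add: algebra_simps)
  next
    case 2
    show ?case using mult_left_mono[OF Suc.IH(2), of a] le assms unfolding eq(2)
      by (simp add: algebra_simps)
  }
qed simp_all

definition hat :: "real \<Rightarrow> nat \<Rightarrow> real \<Rightarrow> real" where
  "hat \<delta> j x = max 0 (1 - \<bar>x / \<delta> - real j\<bar>)"

lemma hat_bounds: "0 \<le> hat \<delta> j x" "hat \<delta> j x \<le> 1"
  by (auto simp: hat_def)

lemma continuous_on_hat: "continuous_on A (hat \<delta> j)"
  unfolding hat_def divide_inverse by (intro continuous_intros)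

lemma borel_measurable_hat [measurable]: "hat \<delta> j \<in> borel_measurable borel"
  by (intro borel_measurable_continuous_onI continuous_on_hat)

text \<open>The hats at \<open>0, \<delta>, \<dots>, N \<delta>\<close> form a partition of unity on \<open>[0, N \<delta>]\<close> and their sum never exceeds 1, so
  \<open>1 - (\<Sum>j\<le>N. hat \<delta> j x)\<close> is a continuous cutoff to the tail.\<close>

lemma sum_hat:
  assumes "0 < \<delta>" "0 \<le> x"
  shows "(\<Sum>j\<le>N. hat \<delta> j x) = max 0 (min 1 (real N + 1 - x / \<delta>))"
proof (induction N)
  case 0
  have "0 \<le> x / \<delta>" using assms by simp
  then show ?case using assms by (simp add: hat_def)
next
  case (Suc N)
  then show ?case by (simp add: hat_def max_def min_def abs_if)
qed

text \<open>Pointwise convergence of Stieltjes transforms, along an arbitrary filter and with possibly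
  uncountably many indices, so that it covers convergence in probability.\<close>

locale stieltjes_limit =
  fixes \<nu> :: "'i \<Rightarrow> real measure" and \<mu> :: "real measure" and F :: "'i filter"
  assumes half_line: "eventually (\<lambda>i. half_line_prob (\<nu> i)) F" "half_line_prob \<mu>"
    and stieltjes: "\<And>z. 0 < z \<Longrightarrow> ((\<lambda>i. \<integral>x. 1 / (x + z) \<partial>\<nu> i) \<longlongrightarrow> (\<integral>x. 1 / (x + z) \<partial>\<mu>)) F"
begin

text \<open>The functions against which the measures converge. They form a vector space closed under
  uniform limits on the half-line.\<close>

definition converging :: "(real \<Rightarrow> real) \<Rightarrow> bool" where
  "converging h \<longleftrightarrow> h \<in> borel_measurable borel \<and> (\<exists>B. \<forall>x\<ge>0. \<bar>h x\<bar> \<le> B)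
     \<and> ((\<lambda>i. \<integral>x. h x \<partial>\<nu> i) \<longlongrightarrow> (\<integral>x. h x \<partial>\<mu>)) F"

lemma converging_integrable: "converging h \<Longrightarrow> half_line_prob N \<Longrightarrow> integrable N h"
  unfolding converging_def using integrable_half_line by blast

lemma converging_const: "converging (\<lambda>_. c)"
  unfolding converging_def
proof (intro conjI)
  have "eventually (\<lambda>i. (\<integral>x. c \<partial>\<nu> i) = c) F"
    using half_line(1) by eventually_elim (rule integral_const_half_line)
  then show "((\<lambda>i. \<integral>x. c \<partial>\<nu> i) \<longlongrightarrow> (\<integral>x. c \<partial>\<mu>)) F"
    unfolding integral_const_half_line[OF half_line(2)] by (rule tendsto_eventually)
qed auto

lemma converging_lincomb:
  assumes "converging g" "converging h"
  shows "converging (\<lambda>x. a * g x + b * h x)"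
  unfolding converging_def
proof (intro conjI)
  obtain B C where "\<forall>x\<ge>0. \<bar>g x\<bar> \<le> B" "\<forall>x\<ge>0. \<bar>h x\<bar> \<le> C" using assms by (auto simp: converging_def)
  then have "\<forall>x\<ge>0. \<bar>a * g x + b * h x\<bar> \<le> \<bar>a\<bar> * B + \<bar>b\<bar> * C"
    by (intro allI impI order_trans[OF abs_triangle_ineq] add_mono) (auto simp: abs_mult intro!: mult_left_mono)
  then show "\<exists>B. \<forall>x\<ge>0. \<bar>a * g x + b * h x\<bar> \<le> B" by blast
  have eq: "(\<integral>x. a * g x + b * h x \<partial>N) = a * (\<integral>x. g x \<partial>N) + b * (\<integral>x. h x \<partial>N)"
    if "half_line_prob N" for N
    using converging_integrable[OF assms(1) that] converging_integrable[OF assms(2) that] by simp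
  have "((\<lambda>i. a * (\<integral>x. g x \<partial>\<nu> i) + b * (\<integral>x. h x \<partial>\<nu> i))
      \<longlongrightarrow> a * (\<integral>x. g x \<partial>\<mu>) + b * (\<integral>x. h x \<partial>\<mu>)) F"
    using assms by (intro tendsto_intros) (auto simp: converging_def)
  then show "((\<lambda>i. \<integral>x. a * g x + b * h x \<partial>\<nu> i) \<longlongrightarrow> (\<integral>x. a * g x + b * h x \<partial>\<mu>)) F"
    unfolding eq[OF half_line(2)]
    by (rule Lim_transform_eventually) (use half_line(1) in \<open>eventually_elim, simp add: eq\<close>)
qed (use assms in \<open>auto simp: converging_def\<close>)

lemma converging_sum: "finite A \<Longrightarrow> (\<And>j. j \<in> A \<Longrightarrow> converging (g j)) \<Longrightarrow> converging (\<lambda>x. \<Sum>j\<in>A. a j * g j x)"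
proof (induction A rule: finite_induct)
  case empty
  then show ?case using converging_const[of 0] by simp
next
  case (insert j A)
  then have "converging (\<lambda>x. a j * g j x + 1 * (\<Sum>j\<in>A. a j * g j x))" by (intro converging_lincomb) auto
  then show ?case using insert.hyps by simp
qed

lemma converging_uniform_limit:
  assumes meas: "h \<in> borel_measurable borel"
    and approx: "\<And>e. 0 < e \<Longrightarrow> \<exists>g. converging g \<and> (\<forall>x\<ge>0. \<bar>h x - g x\<bar> \<le> e)"
  shows "converging h"
  unfolding converging_def
proof (intro conjI meas)
  obtain g where g: "converging g" "\<forall>x\<ge>0. \<bar>h x - g x\<bar> \<le> 1" using approx[of 1] by auto
  then obtain B where "\<forall>x\<ge>0. \<bar>g x\<bar> \<le> B" by (auto simp: converging_def)
  then have B: "\<forall>x\<ge>0. \<bar>h x\<bar> \<le> B + 1"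
  proof (intro allI impI)
    fix x :: real assume B: "\<forall>x\<ge>0. \<bar>g x\<bar> \<le> B" and x: "0 \<le> x"
    have "\<bar>h x - g x\<bar> \<le> 1" "\<bar>g x\<bar> \<le> B" using g B x by auto
    then show "\<bar>h x\<bar> \<le> B + 1" by linarith
  qed
  then show "\<exists>B. \<forall>x\<ge>0. \<bar>h x\<bar> \<le> B" by blast
  show "((\<lambda>i. \<integral>x. h x \<partial>\<nu> i) \<longlongrightarrow> (\<integral>x. h x \<partial>\<mu>)) F"
  proof (rule tendstoI)
    fix e :: real assume e: "0 < e"
    obtain g where g: "converging g" "\<forall>x\<ge>0. \<bar>h x - g x\<bar> \<le> e / 4" using approx[of "e / 4"] e by auto
    have close: "\<bar>(\<integral>x. h x \<partial>N) - (\<integral>x. g x \<partial>N)\<bar> \<le> e / 4" if N: "half_line_prob N" for N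
    proof -
      obtain C where C: "\<forall>x\<ge>0. \<bar>g x\<bar> \<le> C" using g(1) by (auto simp: converging_def)
      have "\<bar>(\<integral>x. h x \<partial>N) - (\<integral>x. g x \<partial>N)\<bar> \<le> (\<integral>x. e / 4 \<partial>N)"
        using g B C meas by (intro integral_half_line_diff_le[OF N, of _ _ _ "B + 1" C "\<bar>e / 4\<bar>"]) (auto simp: converging_def)
      then show ?thesis unfolding integral_const_half_line[OF N] .
    qed
    have "eventually (\<lambda>i. dist (\<integral>x. g x \<partial>\<nu> i) (\<integral>x. g x \<partial>\<mu>) < e / 4) F"
      using g(1) e by (intro tendstoD) (auto simp: converging_def)
    then show "eventually (\<lambda>i. dist (\<integral>x. h x \<partial>\<nu> i) (\<integral>x. h x \<partial>\<mu>) < e) F"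
      using half_line(1)
    proof eventually_elim
      case (elim i)
      show ?case using close[OF elim(2)] close[OF half_line(2)] elim(1) e
        unfolding dist_real_def by linarith
    qed
  qed
qed

text \<open>The power \<open>k + 2\<close> is, up to a factor, the derivative in \<open>z\<close> of the power \<open>k + 1\<close>, and the difference
  quotients converge uniformly on the half-line.\<close>

lemma converging_resolvent_power: "0 < z \<Longrightarrow> converging (\<lambda>x. (1 / (x + z)) ^ Suc k)"
proof (induction k arbitrary: z)
  case 0
  have "\<forall>x\<ge>0. \<bar>1 / (x + z)\<bar> \<le> 1 / z" using 0 by (auto intro!: frac_le)
  then show ?case using stieltjes[OF 0] unfolding converging_def by auto
next
  case (Suc k)
  define C where "C = real (Suc (Suc k)) * (1 / z) ^ Suc k * (1 / z * (1 / z))"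
  have C: "0 < C" using Suc.prems by (simp add: C_def)
  show ?case
  proof (rule converging_uniform_limit)
    fix e :: real assume e: "0 < e"
    \<comment> \<open>With this \<open>h\<close> the difference quotient is within \<open>h C = e\<close> of the derivative.\<close>
    define h where "h = e / C"
    have h: "0 < h" "h * C = e" using e C by (simp_all add: h_def)
    define m where "m = real (Suc k)"
    have m: "0 < m" by (simp add: m_def)
    let ?g = "\<lambda>x. 1 / (h * m) * (1 / (x + z)) ^ Suc k + (- 1 / (h * m)) * (1 / (x + (z + h))) ^ Suc k"
    have "converging ?g" using Suc h by (intro converging_lincomb Suc.IH) auto
    moreover have "\<bar>(1 / (x + z)) ^ Suc (Suc k) - ?g x\<bar> \<le> e" if x: "0 \<le> x" for x
    proof -
      define a b where "a = 1 / (x + z)" and "b = 1 / (x + (z + h))"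
      have b: "0 \<le> b" "b \<le> a" "a \<le> 1 / z" "0 \<le> a"
        using x h Suc.prems by (auto simp: a_def b_def intro!: frac_le)
      have ab: "a - b = h * (a * b)"
      proof -
        have "x + z \<noteq> 0" "x + (z + h) \<noteq> 0" using x h Suc.prems by auto
        then show ?thesis by (simp add: a_def b_def field_simps)
      qed
      have g: "?g x * (h * m) = a ^ Suc k - b ^ Suc k"
        unfolding a_def[symmetric] b_def[symmetric] using h m by (simp add: field_simps)
      have "?g x * (h * m) \<le> m * a ^ k * (h * (a * b))"
        unfolding g using power_diff_bounds(2)[OF b(1,2), of k] by (simp add: ab m_def)
      also have "\<dots> \<le> m * a ^ k * (h * (a * a))"
        using b h m by (intro mult_left_mono) auto
      also have "\<dots> = a ^ Suc (Suc k) * (h * m)" by simp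
      finally have up: "?g x \<le> a ^ Suc (Suc k)" using h m by (simp only: mult_le_cancel_right_pos mult_pos_pos)
      have "b ^ Suc (Suc k) * (h * m) = m * b ^ k * (h * (b * b))" by simp
      also have "\<dots> \<le> m * b ^ k * (h * (a * b))"
        using b h m by (intro mult_left_mono mult_right_mono) auto
      also have "\<dots> \<le> ?g x * (h * m)"
        unfolding g using power_diff_bounds(1)[OF b(1,2), of k] by (simp add: ab m_def)
      finally have lo: "b ^ Suc (Suc k) \<le> ?g x" using h m by (simp only: mult_le_cancel_right_pos mult_pos_pos)
      have "a ^ Suc (Suc k) - b ^ Suc (Suc k) \<le> real (Suc (Suc k)) * a ^ Suc k * (h * (a * b))"
        using power_diff_bounds(2)[OF b(1,2), of "Suc k"] by (simp only: ab)
      also have "\<dots> \<le> real (Suc (Suc k)) * (1 / z) ^ Suc k * (h * (1 / z * (1 / z)))"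
        using b h Suc.prems by (intro mult_mono power_mono) auto
      also have "\<dots> = e" using h(2) by (simp only: C_def mult_ac)
      finally show ?thesis using up lo unfolding a_def[symmetric] b_def[symmetric] by linarith
    qed
    ultimately show "\<exists>g. converging g \<and> (\<forall>x\<ge>0. \<bar>(1 / (x + z)) ^ Suc (Suc k) - g x\<bar> \<le> e)" by blast
  qed simp
qed

text \<open>In the variable \<open>y = 1 / (x + 1)\<close> a function of compact support is continuous on \<open>[0,1]\<close>, so it is a uniform
  limit of polynomials in \<open>y\<close>.\<close>

lemma converging_compact_support:
  assumes cont: "continuous_on UNIV h" and K: "0 \<le> K" "\<And>x. K \<le> x \<Longrightarrow> h x = 0"
  shows "converging h"
proof (rule converging_uniform_limit)
  show "h \<in> borel_measurable borel" using cont by (rule borel_measurable_continuous_onI)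
  fix e :: real assume e: "0 < e"
  define \<kappa> where "\<kappa> = 1 / (1 + K)"
  have \<kappa>: "0 < \<kappa>" using K(1) by (simp add: \<kappa>_def)
  \<comment> \<open>Clamping at \<open>\<kappa>\<close>, the image of \<open>K\<close>, avoids the pole at 0 and changes nothing as \<open>h\<close> vanishes beyond \<open>K\<close>.\<close>
  define g where "g y = h (1 / max y \<kappa> - 1)" for y
  have "continuous_on {0..1} g"
    unfolding g_def using \<kappa> by (intro continuous_on_compose2[OF cont] continuous_intros) (auto simp: max_def)
  then obtain p where p: "real_polynomial_function p" "\<And>y. y \<in> {0..1} \<Longrightarrow> \<bar>g y - p y\<bar> < e"
    using Stone_Weierstrass_real_polynomial_function[of "{0..1}" g e] e by blast
  obtain a n where a: "p = (\<lambda>y. \<Sum>i\<le>n. a i * y ^ i)" using real_polynomial_function_imp_sum[OF p(1)] by blast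
  have "converging (\<lambda>x. (1 / (x + 1)) ^ i)" for i
    using converging_const[of 1] converging_resolvent_power[of 1] by (cases i) auto
  then have "converging (\<lambda>x. \<Sum>i\<in>{..n}. a i * (1 / (x + 1)) ^ i)" by (intro converging_sum) auto
  moreover have "\<bar>h x - (\<Sum>i\<le>n. a i * (1 / (x + 1)) ^ i)\<bar> \<le> e" if x: "0 \<le> x" for x
  proof -
    have "g (1 / (x + 1)) = h x"
    proof (cases "x \<le> K")
      case True
      then have "\<kappa> \<le> 1 / (x + 1)" using x by (auto simp: \<kappa>_def intro!: frac_le)
      then show ?thesis using x by (simp add: g_def max_def)
    next
      case False
      then have "1 / (x + 1) \<le> \<kappa>" using K(1) by (auto simp: \<kappa>_def intro!: frac_le)
      then have "g (1 / (x + 1)) = h (1 / \<kappa> - 1)" by (simp add: g_def max_absorb2)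
      then show ?thesis using K False by (simp add: \<kappa>_def)
    qed
    moreover have "1 / (x + 1) \<in> {0..1}" using x by simp
    ultimately show ?thesis using p(2)[of "1 / (x + 1)"] by (simp add: a)
  qed
  ultimately show "\<exists>g. converging g \<and> (\<forall>x\<ge>0. \<bar>h x - g x\<bar> \<le> e)" by blast
qed

lemma converging_hat:
  assumes "0 < \<delta>"
  shows "converging (hat \<delta> j)"
proof (rule converging_compact_support[OF continuous_on_hat])
  show "0 \<le> \<delta> * (real j + 1)" using assms by simp
  show "hat \<delta> j x = 0" if "\<delta> * (real j + 1) \<le> x" for x
  proof -
    have "real j + 1 \<le> x / \<delta>" using that assms by (simp add: field_simps)
    then show ?thesis by (simp add: hat_def)
  qed
qed

text \<open>Interpolation at the nodes \<open>j \<delta>\<close>: each hat with \<open>hat \<delta> j x > 0\<close> has its node within \<open>\<delta>\<close> of \<open>x\<close>, which costs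
  at most \<open>\<delta>\<close>; the part not covered by the hats costs at most its mass because \<open>\<bar>f\<bar> \<le> 1\<close>. The error does not
  depend on \<open>f\<close>.\<close>

lemma bl_hat_approx:
  assumes N: "half_line_prob N" and f: "f \<in> bl_ball" and \<delta>: "0 < \<delta>"
  shows "\<bar>(\<integral>x. f x \<partial>N) - (\<Sum>j\<le>m. f (real j * \<delta>) * (\<integral>x. hat \<delta> j x \<partial>N))\<bar>
     \<le> \<delta> + (1 - (\<integral>x. (\<Sum>j\<le>m. hat \<delta> j x) \<partial>N))"
proof -
  have int: "integrable N (hat \<delta> j)" for j
    using integrable_half_line[OF N, of "hat \<delta> j" 1] hat_bounds by (simp add: abs_le_iff)
  let ?T = "\<lambda>x. \<Sum>j\<le>m. hat \<delta> j x" and ?g = "\<lambda>x. \<Sum>j\<le>m. f (real j * \<delta>) * hat \<delta> j x"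
  have [measurable]: "f \<in> borel_measurable borel"
    using bl_ballD(1)[OF f] by (rule borel_measurable_continuous_onI)
  have T: "0 \<le> ?T x" "?T x \<le> 1" if "0 \<le> x" for x
    unfolding sum_hat[OF \<delta> that] by auto
  have pt: "\<bar>f x - ?g x\<bar> \<le> \<delta> + (1 - ?T x)" if x: "0 \<le> x" for x
  proof -
    have "f x - ?g x = f x * (1 - ?T x) + (\<Sum>j\<le>m. (f x - f (real j * \<delta>)) * hat \<delta> j x)"
      by (simp add: left_diff_distrib sum_subtractf sum_distrib_left right_diff_distrib)
    then have 1: "\<bar>f x - ?g x\<bar> \<le> \<bar>f x * (1 - ?T x)\<bar> + (\<Sum>j\<le>m. \<bar>(f x - f (real j * \<delta>)) * hat \<delta> j x\<bar>)"
      using order_trans[OF abs_triangle_ineq add_left_mono[OF sum_abs]] by simp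
    have 2: "\<bar>f x * (1 - ?T x)\<bar> \<le> 1 * (1 - ?T x)"
      unfolding abs_mult using bl_ballD(2)[OF f, of x] T[OF x] by (intro mult_mono) auto
    have 3: "(\<Sum>j\<le>m. \<bar>(f x - f (real j * \<delta>)) * hat \<delta> j x\<bar>) \<le> (\<Sum>j\<le>m. \<delta> * hat \<delta> j x)"
    proof (rule sum_mono)
      fix j
      show "\<bar>(f x - f (real j * \<delta>)) * hat \<delta> j x\<bar> \<le> \<delta> * hat \<delta> j x"
      proof (cases "\<bar>x / \<delta> - real j\<bar> < 1")
        case True
        have "\<bar>x - real j * \<delta>\<bar> = \<delta> * \<bar>x / \<delta> - real j\<bar>"
        proof -
          have "x - real j * \<delta> = \<delta> * (x / \<delta> - real j)" using \<delta> by (simp add: field_simps)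
          then have "\<bar>x - real j * \<delta>\<bar> = \<bar>\<delta>\<bar> * \<bar>x / \<delta> - real j\<bar>" by (simp only: abs_mult)
          then show ?thesis using \<delta> by simp
        qed
        also have "\<dots> \<le> \<delta>" using True \<delta> by simp
        finally have "\<bar>f x - f (real j * \<delta>)\<bar> \<le> \<delta>"
          using bl_ballD(3)[OF f, of x "real j * \<delta>"] by simp
        then show ?thesis using hat_bounds[of \<delta> j x] by (simp add: abs_mult mult_right_mono)
      next
        case False
        then show ?thesis by (simp add: hat_def)
      qed
    qed
    have 4: "(\<Sum>j\<le>m. \<delta> * hat \<delta> j x) \<le> \<delta> * 1"
      unfolding sum_distrib_left[symmetric] using T[OF x] \<delta> by (intro mult_left_mono) auto
    show ?thesis using order_trans[OF 1 add_mono[OF 2 order_trans[OF 3 4]]] by simp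
  qed
  have gb: "\<bar>?g x\<bar> \<le> 1" if x: "0 \<le> x" for x
  proof -
    have "\<bar>?g x\<bar> \<le> (\<Sum>j\<le>m. \<bar>f (real j * \<delta>) * hat \<delta> j x\<bar>)" by (rule sum_abs)
    also have "\<dots> \<le> (\<Sum>j\<le>m. 1 * hat \<delta> j x)"
      unfolding abs_mult using bl_ballD(2)[OF f] hat_bounds
      by (intro sum_mono mult_mono) auto
    also have "\<dots> \<le> 1" using T[OF x] by simp
    finally show ?thesis .
  qed
  have "\<bar>(\<integral>x. f x \<partial>N) - (\<integral>x. ?g x \<partial>N)\<bar> \<le> (\<integral>x. \<delta> + (1 - ?T x) \<partial>N)"
  proof (rule integral_half_line_diff_le[OF N, where B = 1 and C = 1 and E = "\<delta> + 1"])
    show "\<bar>\<delta> + (1 - ?T x)\<bar> \<le> \<delta> + 1" if "0 \<le> x" for x using T[OF that] \<delta> by simp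
  qed (use pt gb bl_ballD(2)[OF f] in auto)
  moreover have "(\<integral>x. ?g x \<partial>N) = (\<Sum>j\<le>m. f (real j * \<delta>) * (\<integral>x. hat \<delta> j x \<partial>N))"
    using int by (subst Bochner_Integration.integral_sum) auto
  moreover have "(\<integral>x. \<delta> + (1 - ?T x) \<partial>N) = \<delta> + (1 - (\<integral>x. ?T x \<partial>N))"
  proof -
    interpret prob_space N using N by (simp add: half_line_prob_def)
    have "integrable N ?T" using int by simp
    then show ?thesis using prob_space by simp
  qed
  ultimately show ?thesis by simp
qed

text \<open>The limit measure is tight, so finitely many hats carry all but \<open>\<delta>\<close> of its mass; convergence against these
  hats bounds the tail mass of \<open>\<nu> i\<close> and all interpolation sums simultaneously.\<close>

lemma bl_dist_small:
  assumes "0 < \<epsilon>"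
  shows "eventually (\<lambda>i. bl_dist (\<nu> i) \<mu> \<le> \<epsilon>) F"
proof -
  define \<delta> where "\<delta> = \<epsilon> / 6"
  have \<delta>: "0 < \<delta>" using assms by (simp add: \<delta>_def)
  let ?T = "\<lambda>m x. \<Sum>j\<le>m. hat \<delta> j x"
  have "(\<lambda>m. \<integral>x. ?T m x \<partial>\<mu>) \<longlonglongrightarrow> (\<integral>x. 1 \<partial>\<mu>)"
  proof (rule integral_dominated_convergence[where w = "\<lambda>_. 1"])
    interpret prob_space \<mu> using half_line(2) by (simp add: half_line_prob_def)
    have sets: "sets \<mu> = sets borel" using half_line(2) by (simp add: half_line_prob_def)
    show "(\<lambda>_. 1) \<in> borel_measurable \<mu>" "integrable \<mu> (\<lambda>_. 1::real)" by auto
    show "?T m \<in> borel_measurable \<mu>" for m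
      unfolding measurable_cong_sets[OF sets refl] by measurable
    have pos: "AE x in \<mu>. 0 \<le> x" using half_line(2) by (simp add: half_line_prob_def)
    then show "AE x in \<mu>. (\<lambda>m. ?T m x) \<longlonglongrightarrow> 1"
    proof eventually_elim
      case (elim x)
      have "eventually (\<lambda>m. x / \<delta> \<le> real m) sequentially"
        using filterlim_real_sequentially by (simp add: filterlim_at_top)
      then have "eventually (\<lambda>m. ?T m x = 1) sequentially"
        by eventually_elim (simp add: sum_hat[OF \<delta> elim])
      then show ?case by (rule tendsto_eventually)
    qed
    show "AE x in \<mu>. norm (?T m x) \<le> 1" for m
      using pos by eventually_elim (simp add: sum_hat[OF \<delta>])
  qed
  then have "eventually (\<lambda>m. dist (\<integral>x. ?T m x \<partial>\<mu>) 1 < \<delta>) sequentially"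
    using \<delta> integral_const_half_line[OF half_line(2), of 1] by (intro tendstoD) auto
  then obtain m where m: "dist (\<integral>x. ?T m x \<partial>\<mu>) 1 < \<delta>"
    by (auto simp: eventually_sequentially)
  have "converging (\<lambda>x. \<Sum>j\<in>{..m}. 1 * hat \<delta> j x)" using converging_hat[OF \<delta>] by (intro converging_sum) auto
  then have "((\<lambda>i. \<integral>x. ?T m x \<partial>\<nu> i) \<longlongrightarrow> (\<integral>x. ?T m x \<partial>\<mu>)) F" by (simp add: converging_def)
  then have "eventually (\<lambda>i. dist (\<integral>x. ?T m x \<partial>\<nu> i) (\<integral>x. ?T m x \<partial>\<mu>) < \<delta>) F"
    using \<delta> by (rule tendstoD)
  moreover have "((\<lambda>i. \<Sum>j\<le>m. \<bar>(\<integral>x. hat \<delta> j x \<partial>\<nu> i) - (\<integral>x. hat \<delta> j x \<partial>\<mu>)\<bar>)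
      \<longlongrightarrow> (\<Sum>j\<le>m. \<bar>(\<integral>x. hat \<delta> j x \<partial>\<mu>) - (\<integral>x. hat \<delta> j x \<partial>\<mu>)\<bar>)) F"
    using converging_hat[OF \<delta>] by (intro tendsto_intros) (auto simp: converging_def)
  then have "eventually (\<lambda>i. dist (\<Sum>j\<le>m. \<bar>(\<integral>x. hat \<delta> j x \<partial>\<nu> i) - (\<integral>x. hat \<delta> j x \<partial>\<mu>)\<bar>) 0 < \<delta>) F"
    using \<delta> by (intro tendstoD) auto
  ultimately show ?thesis using half_line(1)
  proof eventually_elim
    case (elim i)
    show ?case unfolding bl_dist_def
    proof (rule cSUP_least)
      show "bl_ball \<noteq> ({} :: (real \<Rightarrow> real) set)" using zero_in_bl_ball by blast
      fix f :: "real \<Rightarrow> real" assume f: "f \<in> bl_ball"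
      let ?h = "\<lambda>N. \<Sum>j\<le>m. f (real j * \<delta>) * (\<integral>x. hat \<delta> j x \<partial>N)"
      have "?h (\<nu> i) - ?h \<mu> = (\<Sum>j\<le>m. f (real j * \<delta>) * ((\<integral>x. hat \<delta> j x \<partial>\<nu> i) - (\<integral>x. hat \<delta> j x \<partial>\<mu>)))"
        by (simp add: right_diff_distrib sum_subtractf)
      also have "\<bar>\<dots>\<bar> \<le> (\<Sum>j\<le>m. \<bar>f (real j * \<delta>) * ((\<integral>x. hat \<delta> j x \<partial>\<nu> i) - (\<integral>x. hat \<delta> j x \<partial>\<mu>))\<bar>)"
        by (rule sum_abs)
      also have "\<dots> \<le> (\<Sum>j\<le>m. 1 * \<bar>(\<integral>x. hat \<delta> j x \<partial>\<nu> i) - (\<integral>x. hat \<delta> j x \<partial>\<mu>)\<bar>)"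
        unfolding abs_mult using bl_ballD(2)[OF f] by (intro sum_mono mult_right_mono) auto
      also have "\<dots> \<le> \<delta>" using elim(2) by (simp add: dist_real_def)
      finally have "\<bar>?h (\<nu> i) - ?h \<mu>\<bar> \<le> \<delta>" .
      moreover note bl_hat_approx[OF elim(3) f \<delta>, of m] bl_hat_approx[OF half_line(2) f \<delta>, of m]
      moreover note m elim(1)
      ultimately show "\<bar>(\<integral>x. f x \<partial>\<nu> i) - (\<integral>x. f x \<partial>\<mu>)\<bar> \<le> \<epsilon>"
        unfolding \<delta>_def dist_real_def by linarith
    qed
  qed
qed

end

section \<open>Concentration for the Jacobi ensemble\<close>

text \<open>A property of pairs \<open>(n, \<omega>)\<close> holds eventually along this filter iff it holds outside measurable events whose
  probabilities tend to 0. A limit along it is a limit in probability, and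
  the properties themselves may fail to be measurable.\<close>

definition whp :: "(nat \<Rightarrow> 'a measure) \<Rightarrow> (nat \<times> 'a) filter" where
  "whp M = Abs_filter (\<lambda>P. \<exists>A. (\<forall>\<^sub>F n in sequentially. A n \<in> sets (M n) \<and> (\<forall>\<omega>\<in>space (M n) - A n. P (n, \<omega>)))
     \<and> (\<lambda>n. emeasure (M n) (A n)) \<longlonglongrightarrow> 0)"

lemma eventually_whp:
  "eventually P (whp M) \<longleftrightarrow>
     (\<exists>A. (\<forall>\<^sub>F n in sequentially. A n \<in> sets (M n) \<and> (\<forall>\<omega>\<in>space (M n) - A n. P (n, \<omega>)))
        \<and> (\<lambda>n. emeasure (M n) (A n)) \<longlonglongrightarrow> 0)"
  unfolding whp_def
proof (rule eventually_Abs_filter, rule is_filter.intro, goal_cases)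
  case 1
  show ?case by (rule exI[of _ "\<lambda>_. {}"]) auto
next
  case (2 P Q)
  then obtain A B where A: "\<forall>\<^sub>F n in sequentially. A n \<in> sets (M n) \<and> (\<forall>\<omega>\<in>space (M n) - A n. P (n, \<omega>))"
      "(\<lambda>n. emeasure (M n) (A n)) \<longlonglongrightarrow> 0"
    and B: "\<forall>\<^sub>F n in sequentially. B n \<in> sets (M n) \<and> (\<forall>\<omega>\<in>space (M n) - B n. Q (n, \<omega>))"
      "(\<lambda>n. emeasure (M n) (B n)) \<longlonglongrightarrow> 0"
    by blast
  have "(\<lambda>n. emeasure (M n) (A n \<union> B n)) \<longlonglongrightarrow> 0"
  proof (rule tendsto_sandwich[of "\<lambda>_. 0" _ _ "\<lambda>n. emeasure (M n) (A n) + emeasure (M n) (B n)"])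
    show "\<forall>\<^sub>F n in sequentially. emeasure (M n) (A n \<union> B n) \<le> emeasure (M n) (A n) + emeasure (M n) (B n)"
      using A(1) B(1) by eventually_elim (auto intro: emeasure_subadditive)
    show "(\<lambda>n. emeasure (M n) (A n) + emeasure (M n) (B n)) \<longlonglongrightarrow> 0"
      using tendsto_add[OF A(2) B(2)] by simp
  qed auto
  moreover have "\<forall>\<^sub>F n in sequentially. A n \<union> B n \<in> sets (M n) \<and> (\<forall>\<omega>\<in>space (M n) - (A n \<union> B n). P (n, \<omega>) \<and> Q (n, \<omega>))"
    using A(1) B(1) by eventually_elim auto
  ultimately show ?case by (intro exI[of _ "\<lambda>n. A n \<union> B n"]) blast
next
  case (3 P Q)
  then obtain A where A: "\<forall>\<^sub>F n in sequentially. A n \<in> sets (M n) \<and> (\<forall>\<omega>\<in>space (M n) - A n. P (n, \<omega>))"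
      "(\<lambda>n. emeasure (M n) (A n)) \<longlonglongrightarrow> 0" by blast
  from A(1) have "\<forall>\<^sub>F n in sequentially. A n \<in> sets (M n) \<and> (\<forall>\<omega>\<in>space (M n) - A n. Q (n, \<omega>))"
    by eventually_elim (use 3(1) in blast)
  then show ?case using A(2) by blast
qed

lemma emeasure_exp_ge_le:
  assumes L: "L \<in> borel_measurable M" and le: "(\<integral>\<^sup>+\<omega>. ennreal (exp (L \<omega>)) \<partial>M) \<le> 1"
  shows "{\<omega>\<in>space M. K \<le> L \<omega>} \<in> sets M"
    and "emeasure M {\<omega>\<in>space M. K \<le> L \<omega>} \<le> ennreal (exp (- K))"
proof -
  note [measurable] = L
  show "{\<omega>\<in>space M. K \<le> L \<omega>} \<in> sets M" by measurable
  have "{\<omega>\<in>space M. K \<le> L \<omega>} = {\<omega>\<in>space M. 1 \<le> ennreal (exp (- K)) * ennreal (exp (L \<omega>))}"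
  proof -
    have "K \<le> L \<omega> \<longleftrightarrow> 1 \<le> ennreal (exp (- K)) * ennreal (exp (L \<omega>))" for \<omega>
    proof -
      have "ennreal (exp (- K)) * ennreal (exp (L \<omega>)) = ennreal (exp (- K + L \<omega>))"
        unfolding exp_add by (simp add: ennreal_mult')
      then show ?thesis by (simp only: ennreal_ge_1 one_le_exp_iff) linarith
    qed
    then show ?thesis by simp
  qed
  also have "emeasure M \<dots> \<le> ennreal (exp (- K)) * (\<integral>\<^sup>+\<omega>. ennreal (exp (L \<omega>)) * indicator (space M) \<omega> \<partial>M)"
    by (rule nn_integral_Markov_inequality) auto
  also have "\<dots> \<le> ennreal (exp (- K)) * 1"
    using le by (intro mult_left_mono) (auto cong: nn_integral_cong)
  finally show "emeasure M {\<omega>\<in>space M. K \<le> L \<omega>} \<le> ennreal (exp (- K))" by simp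
qed

text \<open>If \<open>mp_quadratic\<close> exceeds \<open>\<kappa>\<close>, then the expansion makes the log-likelihood ratio for \<open>t = \<tau> s\<close> at least
  \<open>\<tau> n\<^sup>2 \<kappa> / 2\<close>, as the two errors take away at most a quarter of \<open>\<tau> n\<^sup>2 \<kappa>\<close> each; if it is below
  \<open>- \<kappa>\<close>, the same holds for \<open>t = - \<tau> s\<close>. Both events are rare because the likelihood ratios have mean 1.\<close>

lemma jacobi_concentration:
  fixes l :: "nat \<Rightarrow> 'a \<Rightarrow> real"
  assumes M: "prob_space M"
    and dist: "distributed M (Pi\<^sub>M {1..n} (\<lambda>_. lborel)) (\<lambda>\<omega>. \<lambda>i\<in>{1..n}. l i \<omega>)
             (\<lambda>x. ennreal (jacobi_density n \<beta> a1 a2 x))"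
    and pos: "0 < n" "0 < \<beta>" "0 < s" "0 < z" "0 < \<tau>" and a2: "a2 = real n / s"
    and small: "\<tau> * (s + 1 / z) \<le> 1 / 2" "lin_err n \<beta> \<gamma> z s (a1 - jacobi_p n \<beta>) \<le> \<kappa> / 4"
      "\<tau> * quad_err n \<beta> z s (a1 - jacobi_p n \<beta>) \<le> \<kappa> / 4"
  shows "\<exists>A\<in>sets M. emeasure M A \<le> ennreal (2 * exp (- (\<tau> * (real n)\<^sup>2 * (\<kappa> / 2)))) \<and>
    (\<forall>\<omega>\<in>space M - A. (\<forall>i\<in>{1..n}. l i \<omega> \<in> {0..1}) \<and>
       \<bar>mp_quadratic \<beta> \<gamma> z (emp_stieltjes n z (\<lambda>i. l i \<omega> / s))\<bar> \<le> \<kappa>)"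
proof -
  interpret prob_space M by fact
  let ?P = "Pi\<^sub>M {1..n} (\<lambda>_. lborel :: real measure)" and ?X = "\<lambda>\<omega>. \<lambda>i\<in>{1..n}. l i \<omega>"
  let ?\<rho> = "\<lambda>x. ennreal (jacobi_density n \<beta> a1 a2 x)"
  let ?b1 = "a1 - jacobi_p n \<beta>"
  define K where "K = \<tau> * (real n)\<^sup>2 * (\<kappa> / 2)"
  define L where "L \<sigma> \<omega> = log_ratio n \<beta> ?b1 (a2 - jacobi_p n \<beta>) (s * z) (\<sigma> * s) (?X \<omega>)" for \<sigma> \<omega>
  define G where "G \<sigma> = {\<omega>\<in>space M. K \<le> L \<sigma> \<omega>}" for \<sigma>
  define C where "C = {x \<in> space ?P. \<not> (\<forall>i\<in>{1..n}. x i \<in> {0..1})}"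
  have X[measurable]: "?X \<in> measurable M ?P" using dist by (simp add: distributed_def)
  have \<rho>: "?\<rho> \<in> borel_measurable ?P" using dist by (simp add: distributed_def)
  have C[measurable]: "C \<in> sets ?P" unfolding C_def by measurable
  have c: "?X -` C \<inter> space M \<in> sets M" by (rule measurable_sets[OF X C])
  have "emeasure M (?X -` C \<inter> space M) = (\<integral>\<^sup>+\<omega>. indicator (?X -` C \<inter> space M) \<omega> \<partial>M)"
    using c by (rule nn_integral_indicator[symmetric])
  also have "\<dots> = (\<integral>\<^sup>+\<omega>. indicator C (?X \<omega>) \<partial>M)"
    by (intro nn_integral_cong) (auto simp: indicator_def)
  also have "\<dots> = (\<integral>\<^sup>+x. ?\<rho> x * indicator C x \<partial>?P)"
    using borel_measurable_indicator[OF C] by (rule distributed_nn_integral[OF dist, symmetric])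
  also have "\<dots> = (\<integral>\<^sup>+x. 0 \<partial>?P)"
  proof (rule nn_integral_cong)
    fix x
    have "jacobi_density n \<beta> a1 a2 x = 0" if "\<not> (\<forall>i\<in>{1..n}. x i \<in> {0..1})"
      using that unfolding jacobi_density_def Let_def by (rule if_not_P)
    then show "?\<rho> x * indicator C x = 0" unfolding C_def indicator_def by (cases "\<forall>i\<in>{1..n}. x i \<in> {0..1}") auto
  qed
  finally have C0: "emeasure M (?X -` C \<inter> space M) = 0" by simp
  have G: "G \<sigma> \<in> sets M" "emeasure M (G \<sigma>) \<le> ennreal (exp (- K))" if "\<bar>\<sigma>\<bar> = \<tau>" for \<sigma>
  proof -
    have Lm: "L \<sigma> \<in> borel_measurable M"
      unfolding L_def by (rule measurable_compose[OF X borel_measurable_log_ratio])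
    have "\<bar>\<sigma> * s\<bar> * (1 + 1 / (s * z)) = \<tau> * (s + 1 / z)"
      using pos that by (simp add: abs_mult field_simps)
    then have t: "\<bar>\<sigma> * s\<bar> * (1 + 1 / (s * z)) \<le> 1 / 2" using small(1) by simp
    have "(\<integral>\<^sup>+\<omega>. ennreal (exp (L \<sigma> \<omega>)) \<partial>M)
        = (\<integral>\<^sup>+x. ?\<rho> x * ennreal (exp (log_ratio n \<beta> ?b1 (a2 - jacobi_p n \<beta>) (s * z) (\<sigma> * s) x)) \<partial>?P)"
      unfolding L_def
      by (rule distributed_nn_integral[OF dist, symmetric]) measurable
    also have "\<dots> = (\<integral>\<^sup>+x. ?\<rho> x \<partial>?P)"
      using pos by (intro nn_integral_jacobi_deform t \<rho>) simp
    also have "\<dots> = (\<integral>\<^sup>+\<omega>. 1 \<partial>M)"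
      using distributed_nn_integral[OF dist, of "\<lambda>_. 1"] by simp
    also have "\<dots> = 1" by (simp add: emeasure_space_1)
    finally have le: "(\<integral>\<^sup>+\<omega>. ennreal (exp (L \<sigma> \<omega>)) \<partial>M) \<le> 1" by simp
    show "G \<sigma> \<in> sets M" "emeasure M (G \<sigma>) \<le> ennreal (exp (- K))"
      unfolding G_def by (rule emeasure_exp_ge_le[OF Lm le])+
  qed
  let ?A = "(?X -` C \<inter> space M) \<union> (G \<tau> \<union> G (- \<tau>))"
  show ?thesis
  proof (intro bexI conjI ballI)
    have g: "G \<tau> \<in> sets M" "G (-\<tau>) \<in> sets M" using G(1) pos by auto

    show "?A \<in> sets M" using g c by auto
    have "emeasure M ?A \<le> 0 + (emeasure M (G \<tau>) + emeasure M (G (- \<tau>)))"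
      unfolding C0[symmetric] using g c
      by (intro order_trans[OF emeasure_subadditive] add_left_mono emeasure_subadditive) auto
    also have "\<dots> \<le> 0 + (ennreal (exp (- K)) + ennreal (exp (- K)))"
      using G(2) pos by (intro add_mono) auto
    also have "\<dots> = ennreal (2 * exp (- K))" by (simp add: ennreal_plus[symmetric] del: ennreal_plus)
    finally show "emeasure M ?A \<le> ennreal (2 * exp (- (\<tau> * (real n)\<^sup>2 * (\<kappa> / 2))))" by (simp only: K_def)
    fix \<omega> assume \<omega>: "\<omega> \<in> space M - ?A"
    have "?X \<omega> \<in> space ?P" using \<omega> X by (auto dest: measurable_space)
    then have cube: "\<forall>i\<in>{1..n}. ?X \<omega> i \<in> {0..1}" using \<omega> unfolding C_def by blast
    then show "l i \<omega> \<in> {0..1}" if "i \<in> {1..n}" for i using that by force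
    let ?S = "emp_stieltjes n z (\<lambda>i. l i \<omega> / s)"
    have S: "emp_stieltjes n z (\<lambda>i. ?X \<omega> i / s) = ?S" by (simp add: emp_stieltjes_def)
    have N: "0 < (real n)\<^sup>2" using pos by simp
    have up: "\<sigma> * mp_quadratic \<beta> \<gamma> z ?S < \<tau> * \<kappa>" if \<sigma>: "\<sigma> \<in> {\<tau>, - \<tau>}" for \<sigma>
    proof -
      have abs: "\<bar>\<sigma>\<bar> = \<tau>" "\<sigma>\<^sup>2 = \<tau> * \<tau>" using \<sigma> pos by (auto simp: power2_eq_square)
      have "L \<sigma> \<omega> < K" using \<omega> \<sigma> unfolding G_def by auto
      moreover have "\<bar>L \<sigma> \<omega> - \<sigma> * (real n)\<^sup>2 * mp_quadratic \<beta> \<gamma> z ?S\<bar>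
        \<le> (real n)\<^sup>2 * (\<bar>\<sigma>\<bar> * lin_err n \<beta> \<gamma> z s ?b1 + \<sigma>\<^sup>2 * quad_err n \<beta> z s ?b1)"
        unfolding L_def a2 S[symmetric] using small(1) cube pos abs
        by (intro log_ratio_expansion) auto
      moreover have "(real n)\<^sup>2 * (\<bar>\<sigma>\<bar> * lin_err n \<beta> \<gamma> z s ?b1 + \<sigma>\<^sup>2 * quad_err n \<beta> z s ?b1)
        \<le> (real n)\<^sup>2 * (\<tau> * (\<kappa> / 4) + \<tau> * (\<kappa> / 4))"
        unfolding abs mult.assoc using small(2,3) pos by (intro mult_left_mono add_mono) auto
      ultimately have "\<sigma> * (real n)\<^sup>2 * mp_quadratic \<beta> \<gamma> z ?S < K + (real n)\<^sup>2 * (\<tau> * (\<kappa> / 4) + \<tau> * (\<kappa> / 4))"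
        by linarith
      also have "\<dots> = (\<tau> * \<kappa>) * (real n)\<^sup>2" by (simp add: K_def algebra_simps)
      finally have "(\<sigma> * mp_quadratic \<beta> \<gamma> z ?S) * (real n)\<^sup>2 < (\<tau> * \<kappa>) * (real n)\<^sup>2" by (simp only: mult_ac)
      then show ?thesis using N by (simp only: mult_less_cancel_right_pos)
    qed
    have "\<tau> * mp_quadratic \<beta> \<gamma> z ?S < \<tau> * \<kappa>" "\<tau> * (- mp_quadratic \<beta> \<gamma> z ?S) < \<tau> * \<kappa>"
      using up[of \<tau>] up[of "-\<tau>"] by simp_all
    then have "mp_quadratic \<beta> \<gamma> z ?S < \<kappa>" "- mp_quadratic \<beta> \<gamma> z ?S < \<kappa>"
      using pos by (simp_all only: mult_less_cancel_left_pos)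
    then show "\<bar>mp_quadratic \<beta> \<gamma> z ?S\<bar> \<le> \<kappa>" by linarith
  qed
qed

lemma half_line_prob_empirical:
  assumes "0 < n" "\<forall>i\<in>{1..n}. 0 \<le> x i"
  shows "half_line_prob (empirical_measure n x)"
proof -
  have n: "n \<ge> 1" using assms by simp
  have m: "x \<in> measurable (uniform_count_measure {1..n}) borel"
    by (auto simp: measurable_def space_uniform_count_measure sets_uniform_count_measure)
  have "AE y in distr (uniform_count_measure {1..n}) borel x. 0 \<le> y"
    using assms by (subst AE_distr_iff[OF m]) (auto simp: space_uniform_count_measure intro!: AE_I2)
  then show ?thesis
    using prob_space_empirical_measure[OF n, of x]
    unfolding half_line_prob_def empirical_measure_eq[OF n] by simp
qed

text \<open>The growth conditions in the form used below: the scale \<open>n / a2\<close> vanishes, and \<open>a1\<close> and \<open>p\<close> grow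
  linearly in \<open>n\<close>.\<close>

lemma jacobi_rates:
  fixes a1 a2 :: "nat \<Rightarrow> real" and \<beta> \<gamma> :: real
  assumes "0 < \<beta>" "0 < \<gamma>" "filterlim a2 at_top sequentially" "real \<in> o(\<lambda>n. sqrt (a2 n))"
    and "(\<lambda>n. real n * \<beta> / (2 * a1 n)) \<longlonglongrightarrow> \<gamma>"
  shows "(\<lambda>n. real n / a2 n) \<longlonglongrightarrow> 0"
    and "(\<lambda>n. (a1 n - jacobi_p n \<beta>) / real n) \<longlonglongrightarrow> \<beta> / (2 * \<gamma>) - \<beta> / 2"
    and "(\<lambda>n. jacobi_p n \<beta> / real n) \<longlonglongrightarrow> \<beta> / 2"
proof -
  have a2: "eventually (\<lambda>n. 1 \<le> a2 n) sequentially"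
    using assms(3) by (simp add: filterlim_at_top)
  have "(\<lambda>n. real n / sqrt (a2 n)) \<longlonglongrightarrow> 0" using assms(4) by (rule smalloD_tendsto)
  moreover have "(\<lambda>n. inverse (sqrt (a2 n))) \<longlonglongrightarrow> 0"
    by (intro tendsto_inverse_0_at_top filterlim_compose[OF sqrt_at_top assms(3)])
  ultimately have "(\<lambda>n. real n / sqrt (a2 n) * inverse (sqrt (a2 n))) \<longlonglongrightarrow> 0 * 0"
    by (rule tendsto_mult)
  then have "(\<lambda>n. real n / sqrt (a2 n) * inverse (sqrt (a2 n))) \<longlonglongrightarrow> 0" by simp
  then show "(\<lambda>n. real n / a2 n) \<longlonglongrightarrow> 0"
  proof (rule Lim_transform_eventually)
    show "\<forall>\<^sub>F n in sequentially. real n / sqrt (a2 n) * inverse (sqrt (a2 n)) = real n / a2 n"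
      using a2 by eventually_elim (simp add: field_simps)
  qed
  have inv: "(\<lambda>n. 1 / real n) \<longlonglongrightarrow> 0" by (rule lim_1_over_n)
  have "(\<lambda>n. 1 / real n + \<beta> / 2 * (1 - 1 / real n)) \<longlonglongrightarrow> 0 + \<beta> / 2 * (1 - 0)"
    by (intro tendsto_intros inv)
  then have "(\<lambda>n. 1 / real n + \<beta> / 2 * (1 - 1 / real n)) \<longlonglongrightarrow> \<beta> / 2" by simp
  then show p: "(\<lambda>n. jacobi_p n \<beta> / real n) \<longlonglongrightarrow> \<beta> / 2"
  proof (rule Lim_transform_eventually)
    show "\<forall>\<^sub>F n in sequentially. 1 / real n + \<beta> / 2 * (1 - 1 / real n) = jacobi_p n \<beta> / real n"
      using eventually_gt_at_top[of 0] by eventually_elim (simp add: field_simps)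
  qed
  have "(\<lambda>n. \<beta> / 2 * inverse (real n * \<beta> / (2 * a1 n))) \<longlonglongrightarrow> \<beta> / 2 * inverse \<gamma>"
    using assms by (intro tendsto_intros) auto
  then have "(\<lambda>n. a1 n / real n) \<longlonglongrightarrow> \<beta> / 2 * inverse \<gamma>"
  proof (rule Lim_transform_eventually)
    show "\<forall>\<^sub>F n in sequentially. \<beta> / 2 * inverse (real n * \<beta> / (2 * a1 n)) = a1 n / real n"
      using eventually_gt_at_top[of 0] by eventually_elim (use assms(1) in \<open>simp add: field_simps\<close>)
  qed
  then have "(\<lambda>n. a1 n / real n - jacobi_p n \<beta> / real n) \<longlonglongrightarrow> \<beta> / 2 * inverse \<gamma> - \<beta> / 2"
    by (intro tendsto_diff p)
  moreover have "\<beta> / 2 * inverse \<gamma> = \<beta> / (2 * \<gamma>)" using assms(2) by (simp add: divide_simps)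
  ultimately show "(\<lambda>n. (a1 n - jacobi_p n \<beta>) / real n) \<longlonglongrightarrow> \<beta> / (2 * \<gamma>) - \<beta> / 2"
    by (simp only: diff_divide_distrib)
qed

lemma err_limits:
  fixes b1 s :: "nat \<Rightarrow> real" and \<beta> \<gamma> z :: real
  assumes "0 < z" and s: "s \<longlonglongrightarrow> 0" "eventually (\<lambda>n. 0 < s n) sequentially"
    and b: "(\<lambda>n. b1 n / real n) \<longlonglongrightarrow> \<beta> / (2 * \<gamma>) - \<beta> / 2"
    and p: "(\<lambda>n. jacobi_p n \<beta> / real n) \<longlonglongrightarrow> \<beta> / 2"
  shows "(\<lambda>n. lin_err n \<beta> \<gamma> z (s n) (b1 n)) \<longlonglongrightarrow> 0"
    and "convergent (\<lambda>n. quad_err n \<beta> z (s n) (b1 n))"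
proof -
  define A where "A = \<beta> / (2 * \<gamma>) - \<beta> / 2"
  note b' = b[folded A_def]
  have inv: "(\<lambda>n. 1 / real n) \<longlonglongrightarrow> 0" by (rule lim_1_over_n)
  have absb: "(\<lambda>n. \<bar>b1 n / real n\<bar>) \<longlonglongrightarrow> \<bar>A\<bar>" by (intro tendsto_rabs b')
  have "(\<lambda>n. \<beta> / 2 * s n + \<bar>1 - \<beta> / 2\<bar> * (s n + 1 / z) * (1 / real n) + \<bar>b1 n / real n\<bar> * s n
     + \<bar>b1 n / real n - A\<bar> / z + jacobi_p n \<beta> / real n * s n)
     \<longlonglongrightarrow> \<beta> / 2 * 0 + \<bar>1 - \<beta> / 2\<bar> * (0 + 1 / z) * 0 + \<bar>A\<bar> * 0 + \<bar>A - A\<bar> / z + \<beta> / 2 * 0"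
    by (intro tendsto_add tendsto_mult tendsto_divide tendsto_rabs tendsto_diff tendsto_const s(1) inv absb b' p)
       (use assms(1) in auto)
  then show "(\<lambda>n. lin_err n \<beta> \<gamma> z (s n) (b1 n)) \<longlonglongrightarrow> 0"
    by (simp add: lin_err_def A_def)
  have "(\<lambda>n. 2 * (\<beta> * (s n + 1 / z)\<^sup>2 + (\<bar>b1 n / real n\<bar> * (1 / z)\<^sup>2
       + \<bar>s n - jacobi_p n \<beta> / real n * (s n)\<^sup>2\<bar> + (s n + 1 / z)\<^sup>2 * (1 / real n))))
     \<longlonglongrightarrow> 2 * (\<beta> * (0 + 1 / z)\<^sup>2 + (\<bar>A\<bar> * (1 / z)\<^sup>2 + \<bar>0 - \<beta> / 2 * 0\<^sup>2\<bar> + (0 + 1 / z)\<^sup>2 * 0))"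
    by (intro tendsto_add tendsto_mult tendsto_power tendsto_rabs tendsto_diff tendsto_const s(1) inv absb p)
  then have "(\<lambda>n. quad_err n \<beta> z (s n) (b1 n)) \<longlonglongrightarrow>
      2 * (\<beta> * (0 + 1 / z)\<^sup>2 + (\<bar>A\<bar> * (1 / z)\<^sup>2 + \<bar>0 - \<beta> / 2 * 0\<^sup>2\<bar> + (0 + 1 / z)\<^sup>2 * 0))"
  proof (rule Lim_transform_eventually)
    show "\<forall>\<^sub>F n in sequentially. 2 * (\<beta> * (s n + 1 / z)\<^sup>2 + (\<bar>b1 n / real n\<bar> * (1 / z)\<^sup>2
       + \<bar>s n - jacobi_p n \<beta> / real n * (s n)\<^sup>2\<bar> + (s n + 1 / z)\<^sup>2 * (1 / real n))) = quad_err n \<beta> z (s n) (b1 n)"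
      using eventually_gt_at_top[of 0] s(2)
    proof eventually_elim
      case (elim n)
      define J where "J = jacobi_p n \<beta>"
      have "\<bar>real n / s n - J\<bar> * (s n)\<^sup>2 / real n = \<bar>(real n / s n - J) * (s n)\<^sup>2 / real n\<bar>"
        by (simp add: abs_mult)
      also have "(real n / s n - J) * (s n)\<^sup>2 / real n = s n - J / real n * (s n)\<^sup>2"
        using elim by (simp add: field_simps power2_eq_square)
      finally have "\<bar>real n / s n - J\<bar> * (s n)\<^sup>2 / real n = \<bar>s n - J / real n * (s n)\<^sup>2\<bar>" .
      then show ?case
        unfolding quad_err_def J_def[symmetric] by (simp add: add_divide_distrib)
    qed
  qed
  then show "convergent (\<lambda>n. quad_err n \<beta> z (s n) (b1 n))" by (rule convergentI)
qed

text \<open>The step \<open>\<tau>\<close> may be kept fixed as \<open>n\<close> grows, since the error that is quadratic in \<open>\<tau>\<close> is uniformly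
  bounded; the failure probability then decays like \<open>exp (- c n\<^sup>2)\<close>.\<close>

lemma jacobi_stieltjes_convergence:
  fixes \<beta> \<gamma> z :: real and a1 a2 :: "nat \<Rightarrow> real" and l :: "nat \<Rightarrow> nat \<Rightarrow> 'a \<Rightarrow> real"
  assumes pos: "0 < \<beta>" "0 < \<gamma>" "\<gamma> \<le> 1" "0 < z"
    and M: "\<And>n. n \<ge> 2 \<Longrightarrow> prob_space (M n)"
    and dist: "\<And>n. n \<ge> 2 \<Longrightarrow>
           distributed (M n) (Pi\<^sub>M {1..n} (\<lambda>_. lborel)) (\<lambda>\<omega>. \<lambda>i\<in>{1..n}. l n i \<omega>)
             (\<lambda>x. ennreal (jacobi_density n \<beta> (a1 n) (a2 n) x))"
    and a2: "filterlim a2 at_top sequentially" "real \<in> o(\<lambda>n. sqrt (a2 n))"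
    and a1: "(\<lambda>n. real n * \<beta> / (2 * a1 n)) \<longlonglongrightarrow> \<gamma>"
  shows "((\<lambda>(n, \<omega>). emp_stieltjes n z (\<lambda>i. a2 n / real n * l n i \<omega>))
      \<longlongrightarrow> 2 * \<gamma> / \<beta> * mp_stieltjes \<gamma> (2 * \<gamma> / \<beta> * z)) (whp M)"
    and "\<forall>\<^sub>F (n, \<omega>) in whp M. 0 < n \<and> (\<forall>i\<in>{1..n}. 0 \<le> a2 n / real n * l n i \<omega>)"
proof -
  define s where "s n = real n / a2 n" for n
  define b where "b n = a1 n - jacobi_p n \<beta>" for n
  define T where "T = 2 * \<gamma> / \<beta> * mp_stieltjes \<gamma> (2 * \<gamma> / \<beta> * z)"
  note rates = jacobi_rates[OF pos(1,2) a2 a1]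
  have s0: "s \<longlonglongrightarrow> 0" using rates(1) by (simp add: s_def[abs_def])
  have a2pos: "\<forall>\<^sub>F n in sequentially. 0 < a2 n"
    using a2(1) by (simp add: filterlim_at_top_dense)
  have spos: "\<forall>\<^sub>F n in sequentially. 0 < s n"
    using a2pos eventually_gt_at_top[of 0] by eventually_elim (simp add: s_def)
  have b0: "(\<lambda>n. b n / real n) \<longlonglongrightarrow> \<beta> / (2 * \<gamma>) - \<beta> / 2" using rates(2) by (simp add: b_def)
  note errs = err_limits[OF pos(4) s0 spos b0 rates(3)]
  obtain Q where Q: "0 < Q" "\<And>n. \<bar>quad_err n \<beta> z (s n) (b n)\<bar> \<le> Q"
    using convergent_imp_Bseq[OF errs(2)] by (auto simp: Bseq_def)
  have key: "\<forall>\<^sub>F (n, \<omega>) in whp M. 0 < n \<and> 0 < s n \<and> (\<forall>i\<in>{1..n}. l n i \<omega> \<in> {0..1}) \<and>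
      \<bar>mp_quadratic \<beta> \<gamma> z (emp_stieltjes n z (\<lambda>i. l n i \<omega> / s n))\<bar> \<le> \<kappa>" if \<kappa>: "0 < \<kappa>" for \<kappa>
  proof -
    \<comment> \<open>The first bound makes the expansion of the logarithms applicable once \<open>s n \<le> 1\<close>, the second controls
      the quadratic error.\<close>
    define \<tau> where "\<tau> = min (1 / (2 * (1 + 1 / z))) (\<kappa> / (4 * Q))"
    have \<tau>: "0 < \<tau>" "\<tau> * (1 + 1 / z) \<le> 1 / 2" "\<tau> * Q \<le> \<kappa> / 4"
    proof -
      have z1: "0 < 1 + 1 / z" using pos(4) by (simp add: add_pos_pos)
      show "0 < \<tau>" using z1 \<kappa> Q by (simp add: \<tau>_def)
      have "\<tau> * (1 + 1 / z) \<le> 1 / (2 * (1 + 1 / z)) * (1 + 1 / z)"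
        using z1 by (intro mult_right_mono) (auto simp: \<tau>_def)
      also have "\<dots> = 1 / 2" using z1 by simp
      finally show "\<tau> * (1 + 1 / z) \<le> 1 / 2" .
      have "\<tau> * Q \<le> \<kappa> / (4 * Q) * Q" using Q by (intro mult_right_mono) (auto simp: \<tau>_def)
      also have "\<dots> = \<kappa> / 4" using Q by simp
      finally show "\<tau> * Q \<le> \<kappa> / 4" .
    qed
    let ?P = "\<lambda>n \<omega>. (\<forall>i\<in>{1..n}. l n i \<omega> \<in> {0..1}) \<and>
       \<bar>mp_quadratic \<beta> \<gamma> z (emp_stieltjes n z (\<lambda>i. l n i \<omega> / s n))\<bar> \<le> \<kappa>"
    let ?e = "\<lambda>n. ennreal (2 * exp (- (\<tau> * (real n)\<^sup>2 * (\<kappa> / 2))))"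
    have "\<forall>\<^sub>F n in sequentially. s n < 1" using s0 by (rule order_tendstoD) simp
    moreover have "\<forall>\<^sub>F n in sequentially. lin_err n \<beta> \<gamma> z (s n) (b n) < \<kappa> / 4"
      using errs(1) by (rule order_tendstoD) (use \<kappa> in simp)
    ultimately have ev: "\<forall>\<^sub>F n in sequentially. 0 < n \<and> 0 < s n \<and>
      (\<exists>A\<in>sets (M n). emeasure (M n) A \<le> ?e n \<and> (\<forall>\<omega>\<in>space (M n) - A. ?P n \<omega>))"
      using spos a2pos eventually_ge_at_top[of 2]
    proof eventually_elim
      case (elim n)
      have "\<tau> * (s n + 1 / z) \<le> \<tau> * (1 + 1 / z)" using elim \<tau> by (intro mult_left_mono) auto
      then have 1: "\<tau> * (s n + 1 / z) \<le> 1 / 2" using \<tau>(2) by (rule order_trans)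
      have "\<tau> * quad_err n \<beta> z (s n) (b n) \<le> \<tau> * Q"
        using Q(2)[of n] \<tau> by (intro mult_left_mono) auto
      then have 2: "\<tau> * quad_err n \<beta> z (s n) (a1 n - jacobi_p n \<beta>) \<le> \<kappa> / 4"
        unfolding b_def using \<tau>(3) by (rule order_trans)
      have 3: "a2 n = real n / s n" using elim by (simp add: s_def)
      have "\<exists>A\<in>sets (M n). emeasure (M n) A \<le> ?e n \<and> (\<forall>\<omega>\<in>space (M n) - A. ?P n \<omega>)"
        by (rule jacobi_concentration[OF M[OF elim(5)] dist[OF elim(5)] _ pos(1) elim(3) pos(4) \<tau>(1) 3 1 _ 2])
          (use elim in \<open>simp_all add: b_def\<close>)
      then show ?case using elim by simp
    qed
    define B where "B n = (SOME A. A \<in> sets (M n) \<and> emeasure (M n) A \<le> ?e n \<and> (\<forall>\<omega>\<in>space (M n) - A. ?P n \<omega>))" for n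
    have B: "\<forall>\<^sub>F n in sequentially. 0 < n \<and> 0 < s n \<and> B n \<in> sets (M n) \<and> emeasure (M n) (B n) \<le> ?e n \<and> (\<forall>\<omega>\<in>space (M n) - B n. ?P n \<omega>)"
      using ev
    proof eventually_elim
      case (elim n)
      then have "\<exists>A. A \<in> sets (M n) \<and> emeasure (M n) A \<le> ?e n \<and> (\<forall>\<omega>\<in>space (M n) - A. ?P n \<omega>)" by blast
      from someI_ex[OF this] show ?case using elim unfolding B_def by blast
    qed
    have "(\<lambda>n. 2 * exp (- (\<tau> * (real n)\<^sup>2 * (\<kappa> / 2)))) \<longlonglongrightarrow> 0"
      using \<tau>(1) \<kappa> by real_asymp
    then have e0: "?e \<longlonglongrightarrow> 0" using tendsto_ennrealI by fastforce
    have "(\<lambda>n. emeasure (M n) (B n)) \<longlonglongrightarrow> 0"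
      by (rule tendsto_sandwich[OF _ _ tendsto_const e0]) (use B in \<open>auto elim: eventually_mono\<close>)
    moreover have "\<forall>\<^sub>F n in sequentially. B n \<in> sets (M n) \<and> (\<forall>\<omega>\<in>space (M n) - B n. 0 < n \<and> 0 < s n \<and> ?P n \<omega>)"
      using B by eventually_elim blast
    ultimately show ?thesis unfolding eventually_whp by auto
  qed
  have scale: "l n i \<omega> / s n = a2 n / real n * l n i \<omega>" for n i \<omega> by (simp add: s_def)
  show "\<forall>\<^sub>F (n, \<omega>) in whp M. 0 < n \<and> (\<forall>i\<in>{1..n}. 0 \<le> a2 n / real n * l n i \<omega>)"
    using key[OF zero_less_one]
  proof (rule eventually_mono, unfold split_beta)
    have "0 \<le> a2 n / real n * l n i \<omega>" if "0 < s n" "l n i \<omega> \<in> {0..1}" for n i \<omega>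
      using that unfolding scale[symmetric] by auto
    then show "0 < fst p \<and> (\<forall>i\<in>{1..fst p}. 0 \<le> a2 (fst p) / real (fst p) * l (fst p) i (snd p))"
      if "0 < fst p \<and> 0 < s (fst p) \<and> (\<forall>i\<in>{1..fst p}. l (fst p) i (snd p) \<in> {0..1}) \<and>
        \<bar>mp_quadratic \<beta> \<gamma> z (emp_stieltjes (fst p) z (\<lambda>i. l (fst p) i (snd p) / s (fst p)))\<bar> \<le> 1" for p
      using that by blast
  qed
  show "((\<lambda>(n, \<omega>). emp_stieltjes n z (\<lambda>i. a2 n / real n * l n i \<omega>)) \<longlongrightarrow> T) (whp M)"
  proof (rule tendstoI)
    fix e :: real assume e: "0 < e"
    have T: "0 \<le> T" "mp_quadratic \<beta> \<gamma> z T = 0"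
      using mp_quadratic_root[OF pos(1,2,4)] mp_stieltjes_nonneg[of \<gamma> "2 * \<gamma> / \<beta> * z"] pos
      by (simp_all add: T_def)
    have ze: "0 < z * e / 2" using e pos by simp
    show "\<forall>\<^sub>F p in whp M. dist (case p of (n, \<omega>) \<Rightarrow> emp_stieltjes n z (\<lambda>i. a2 n / real n * l n i \<omega>)) T < e"
      using key[OF ze]
    proof (rule eventually_mono, clarify)
      fix n \<omega> assume *: "0 < n" "0 < s n" "\<forall>i\<in>{1..n}. l n i \<omega> \<in> {0..1}"
        "\<bar>mp_quadratic \<beta> \<gamma> z (emp_stieltjes n z (\<lambda>i. l n i \<omega> / s n))\<bar> \<le> z * e / 2"
      let ?S = "emp_stieltjes n z (\<lambda>i. l n i \<omega> / s n)"
      have "0 \<le> ?S" using * pos by (intro emp_stieltjes_bounds) auto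
      then have "z * \<bar>?S - T\<bar> \<le> z * e / 2"
        using mp_quadratic_inverse_bound[OF pos _ T] *(4) by (meson order_trans)
      then have "z * \<bar>?S - T\<bar> \<le> z * (e / 2)" by simp
      then have "\<bar>?S - T\<bar> \<le> e / 2" using pos(4) by (simp only: mult_le_cancel_left_pos)
      then show "dist (emp_stieltjes n z (\<lambda>i. a2 n / real n * l n i \<omega>)) T < e"
        using e unfolding scale dist_real_def by linarith
    qed
  qed
qed

theorem theorem1:
  fixes \<beta> \<gamma> :: real
    and a1 a2 :: "nat \<Rightarrow> real"
    and M :: "nat \<Rightarrow> 'a measure"
    and l :: "nat \<Rightarrow> nat \<Rightarrow> 'a \<Rightarrow> real"
  defines "c \<equiv> 2 * \<gamma> / \<beta>"
  defines "\<mu> \<equiv> (\<lambda>n \<omega>. empirical_measure n (\<lambda>i. a2 n / real n * l n i \<omega>))"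
    and "\<mu>0 \<equiv> density lborel (\<lambda>x. ennreal (c * mp_density \<gamma> (c * x)))"
  assumes "\<beta> > 0" and "\<gamma> \<in> {0<..1}"
    and "\<And>n. n \<ge> 2 \<Longrightarrow> a1 n > \<beta> / 2 * (real n - 1)"
    and "\<And>n. n \<ge> 2 \<Longrightarrow> a2 n > \<beta> / 2 * (real n - 1)"
    and "\<And>n. n \<ge> 2 \<Longrightarrow> prob_space (M n)"
    and "\<And>n. n \<ge> 2 \<Longrightarrow>
           distributed (M n) (Pi\<^sub>M {1..n} (\<lambda>_. lborel)) (\<lambda>\<omega>. \<lambda>i\<in>{1..n}. l n i \<omega>)
             (\<lambda>x. ennreal (jacobi_density n \<beta> (a1 n) (a2 n) x))"
    and "filterlim a1 at_top sequentially"
    and "filterlim a2 at_top sequentially"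
    and "a1 \<in> o(\<lambda>n. sqrt (a2 n))"
    and "real \<in> o(\<lambda>n. sqrt (a2 n))"
    and "(\<lambda>n. real n * \<beta> / (2 * a1 n)) \<longlonglongrightarrow> \<gamma>"
  shows "\<forall>\<epsilon>>0. (\<lambda>n. measure (M n) {\<omega> \<in> space (M n). bl_dist (\<mu> n \<omega>) \<mu>0 > \<epsilon>}) \<longlonglongrightarrow> 0"
proof (intro allI impI)
  fix \<epsilon> :: real assume \<epsilon>: "0 < \<epsilon>"
  have pos: "0 < \<beta>" "0 < \<gamma>" "\<gamma> \<le> 1" "0 < c" using assms(4,5) by (simp_all add: c_def)
  have limit:
    "((\<lambda>(n, \<omega>). emp_stieltjes n z (\<lambda>i. a2 n / real n * l n i \<omega>)) \<longlongrightarrow> c * mp_stieltjes \<gamma> (c * z)) (whp M)"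
    "\<forall>\<^sub>F (n, \<omega>) in whp M. 0 < n \<and> (\<forall>i\<in>{1..n}. 0 \<le> a2 n / real n * l n i \<omega>)" if "0 < z" for z
    unfolding c_def
    by (rule jacobi_stieltjes_convergence[OF pos(1-3) that], fact+)+
  have half: "\<forall>\<^sub>F p in whp M. 0 < fst p \<and> half_line_prob (\<mu> (fst p) (snd p))"
    using limit(2)[OF zero_less_one]
    by (rule eventually_mono) (auto simp: \<mu>_def intro!: half_line_prob_empirical)
  interpret stieltjes_limit "\<lambda>p. \<mu> (fst p) (snd p)" \<mu>0 "whp M"
  proof
    show "\<forall>\<^sub>F p in whp M. half_line_prob (\<mu> (fst p) (snd p))"
      using half by eventually_elim simp
    show "half_line_prob \<mu>0" unfolding \<mu>0_def using pos by (intro half_line_prob_mp)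
    fix z :: real assume z: "0 < z"
    have "(\<integral>x. 1 / (x + z) \<partial>\<mu>0) = c * mp_stieltjes \<gamma> (c * z)"
      unfolding \<mu>0_def using pos z by (intro stieltjes_mp)
    moreover have "\<forall>\<^sub>F p in whp M. (case p of (n, \<omega>) \<Rightarrow> emp_stieltjes n z (\<lambda>i. a2 n / real n * l n i \<omega>))
        = (\<integral>x. 1 / (x + z) \<partial>\<mu> (fst p) (snd p))"
      using half
      by (rule eventually_mono) (auto simp: \<mu>_def emp_stieltjes_def integral_empirical_measure)
    ultimately show "((\<lambda>p. \<integral>x. 1 / (x + z) \<partial>\<mu> (fst p) (snd p)) \<longlongrightarrow> (\<integral>x. 1 / (x + z) \<partial>\<mu>0)) (whp M)"
      using Lim_transform_eventually[OF limit(1)[OF z]] by simp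
  qed
  obtain A where A: "\<forall>\<^sub>F n in sequentially. A n \<in> sets (M n) \<and> (\<forall>\<omega>\<in>space (M n) - A n. bl_dist (\<mu> n \<omega>) \<mu>0 \<le> \<epsilon>)"
      "(\<lambda>n. emeasure (M n) (A n)) \<longlonglongrightarrow> 0"
    using bl_dist_small[OF \<epsilon>] unfolding eventually_whp by auto
  have lim0: "(\<lambda>n. measure (M n) (A n)) \<longlonglongrightarrow> 0"
    unfolding measure_def using A(2) by (intro tendsto_enn2real) (auto simp: zero_ennreal_def[symmetric])
  show "(\<lambda>n. measure (M n) {\<omega> \<in> space (M n). bl_dist (\<mu> n \<omega>) \<mu>0 > \<epsilon>}) \<longlonglongrightarrow> 0"
  proof (rule tendsto_sandwich[OF _ _ tendsto_const lim0])
    show "\<forall>\<^sub>F n in sequentially. measure (M n) {\<omega> \<in> space (M n). bl_dist (\<mu> n \<omega>) \<mu>0 > \<epsilon>} \<le> measure (M n) (A n)"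
      using A(1) eventually_ge_at_top[of 2]
    proof eventually_elim
      case (elim n)
      interpret prob_space "M n" using assms(8) elim by blast
      show ?case using elim by (intro finite_measure_mono) (auto simp: not_le[symmetric])
    qed
  qed auto
qed

end
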